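(* Assign i.i.d. $U[0,1]$ ages to the vertices of $\mathbb{Z}^2$. Let $G_n$ be the subgraph of $\mathbb{Z}^2$ induced on $V_n=[-n,n]^2\cap\mathbb{Z}^2$, and let $T_4(G_n)$ be the first four layers of $G_n$ (computed with degrees in $G_n$). Let $\Theta$ be the probability that $(0,0)$ belongs to an infinite connected component of $T_4(\mathbb{Z}^2)$. Fix $\epsilon\in(0,1)$ and let $GC$ be the largest connected component of $T_4(G_n)$. Then: (i) There exist positive absolute constants $C,M$ such that for all sufficiently large $n$, $\Pr[|GC|<4n^2(1-\epsilon)\Theta]\le e^{-C\epsilon^2 n^{1/5}}+4n^2e^{-Mn^{1/5}}$. (ii) There exists an absolute constant $L$ such that with probability at least $1-n^{-2}$, every connected component of $T_4(G_n)$ other than $GC$ has diameter (as a subset of $\mathbb{Z}^2$) at most $L\log n$.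
   Context: For a graph with vertex ages, $L_i$ is the set of vertices with exactly $i-1$ neighbors of smaller age and $T_4=\bigcup_{i\le 4}L_i$, viewed as an induced subgraph. $\mathbb{Z}^2$ has nearest-neighbor adjacency. *)

theory Defs
  imports "HOL-Probability.Probability" "Graph_Theory.Digraph_Component"
begin

text \<open>Undirected graphs are symmetric digraphs, so that for them the members of
  \<open>pre_digraph.sccs_verts\<close> are exactly the vertex sets of the connected components.\<close>

definition z2_graph :: "(int \<times> int, (int \<times> int) \<times> (int \<times> int)) pre_digraph" where
  "z2_graph = with_proj \<lparr> pverts = UNIV,
     parcs = {(u, v). \<bar>fst u - fst v\<bar> + \<bar>snd u - snd v\<bar> = 1} \<rparr>"

definition box_graph :: "nat \<Rightarrow> (int \<times> int, (int \<times> int) \<times> (int \<times> int)) pre_digraph" where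
  "box_graph n = z2_graph \<restriction> ({- int n..int n} \<times> {- int n..int n})"

text \<open>Layers are numbered from 1. The neighbours are those in \<open>G\<close> itself, which must be locally
  finite for \<open>card\<close> to be meaningful.\<close>

definition layer :: "('v, 'e) pre_digraph \<Rightarrow> ('v \<Rightarrow> real) \<Rightarrow> nat \<Rightarrow> 'v set" where
  "layer G age i = {v \<in> verts G. card {u. u \<rightarrow>\<^bsub>G\<^esub> v \<and> age u < age v} = i - 1}"

definition first_layers :: "('v, 'e) pre_digraph \<Rightarrow> ('v \<Rightarrow> real) \<Rightarrow> nat \<Rightarrow> ('v, 'e) pre_digraph" where
  "first_layers G age k = G \<restriction> (\<Union>i\<in>{1..k}. layer G age i)"

abbreviation graph_components :: "('v, 'e) pre_digraph \<Rightarrow> 'v set set" where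
  "graph_components G \<equiv> pre_digraph.sccs_verts G"

text \<open>A largest component need not be unique, hence a predicate.\<close>

definition largest_component :: "('v, 'e) pre_digraph \<Rightarrow> 'v set \<Rightarrow> bool" where
  "largest_component G K \<longleftrightarrow> K \<in> graph_components G \<and> (\<forall>K'\<in>graph_components G. card K' \<le> card K)"

definition z2_diameter :: "(int \<times> int) set \<Rightarrow> real" where
  "z2_diameter K = diameter ((\<lambda>(x, y). (real_of_int x, real_of_int y)) ` K)"

text \<open>The joint law of i.i.d. uniform ages, on the canonical space of all age assignments.\<close>

definition age_measure :: "(int \<times> int \<Rightarrow> real) measure" where
  "age_measure = (\<Pi>\<^sub>M v\<in>UNIV. uniform_measure lborel {0..1})"

definition Theta :: real where
  "Theta = measure age_measure {age \<in> space age_measure.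
     \<exists>K\<in>graph_components (first_layers z2_graph age 4). (0, 0) \<in> K \<and> infinite K}"

end

theory Submission
  imports Defs "HOL-Real_Asymp.Real_Asymp"
begin

text \<open>A vertex is missing from the first four layers iff all its four neighbours are younger, so the
  vertices deleted from the box are the strict local maxima of the ages in its interior, and the
  boundary of the box survives as part of a single component. The vertices outside a finite
  component that are adjacent to it and to the outside form a set of local maxima that is connected
  under king moves; local maxima are never adjacent, so it is even connected under diagonal moves,
  and a component of sup-diameter \<open>k\<close> that misses the boundary of the box yields a chordless
  diagonal path of \<open>k\<close> steps through local maxima.

  Such a path is exponentially unlikely. Conditionally on the ages on a finite set \<open>X\<close>, the probability
  that \<open>X\<close> consists of local maxima is the product over the neighbours \<open>f\<close> of the minimal age of
  the points of \<open>X\<close> adjacent to \<open>f\<close>; bounding minima by geometric means gives a product over \<open>X\<close> of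
  ages to powers that are at least 3/2 along a chordless path, hence probability at most 2/5 per
  point. There are at most about 2.42 choices per step, and 2.42 * 2/5 < 1.

  With \<open>k\<close> of order \<open>log n\<close> this proves (ii). For (i), take \<open>r = \<lfloor>n powr (1/5)\<rfloor>\<close>: outside an event of
  exponentially small probability in \<open>r\<close>, every vertex joined to distance \<open>r\<close> inside its own ball
  of radius \<open>r\<close> lies in the giant component. This local event has probability at least \<open>Theta\<close>, and
  it is independent for vertices congruent modulo \<open>2 r + 3\<close>, so Hoeffding's inequality applies to each
  residue class.\<close>

section \<open>Boundaries of connected sets in the square lattice\<close>

definition z2_adj :: "int \<times> int \<Rightarrow> int \<times> int \<Rightarrow> bool" where
  "z2_adj u v \<longleftrightarrow> \<bar>fst u - fst v\<bar> + \<bar>snd u - snd v\<bar> = 1"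

definition diag_adj :: "int \<times> int \<Rightarrow> int \<times> int \<Rightarrow> bool" where
  "diag_adj u v \<longleftrightarrow> \<bar>fst u - fst v\<bar> = 1 \<and> \<bar>snd u - snd v\<bar> = 1"

definition sup_dist :: "int \<times> int \<Rightarrow> int \<times> int \<Rightarrow> int" where
  "sup_dist u v = max \<bar>fst u - fst v\<bar> \<bar>snd u - snd v\<bar>"

text \<open>Each step tests only its target; with \<open>u \<in> W\<close> this keeps the whole path
  in \<open>W\<close> and excludes even the trivial path at a point outside
  \<open>W\<close>.\<close>

definition linked :: "(int \<times> int) set \<Rightarrow> int \<times> int \<Rightarrow> int \<times> int \<Rightarrow> bool" where
  "linked W u v \<longleftrightarrow> u \<in> W \<and> (\<lambda>x y. z2_adj x y \<and> y \<in> W)\<^sup>*\<^sup>* u v"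

lemma z2_adj_sym: "z2_adj u v \<Longrightarrow> z2_adj v u"
  unfolding z2_adj_def by linarith

lemma diag_adj_sym: "diag_adj u v \<Longrightarrow> diag_adj v u"
  unfolding diag_adj_def by linarith

lemma linked_refl: "u \<in> W \<Longrightarrow> linked W u u"
  unfolding linked_def by simp

lemma linked_step: "linked W u v \<Longrightarrow> z2_adj v w \<Longrightarrow> w \<in> W \<Longrightarrow> linked W u w"
  unfolding linked_def by (auto intro: rtranclp.rtrancl_into_rtrancl)

lemma linked_induct [consumes 1, case_names refl step]:
  assumes "linked W u v"
    and "u \<in> W \<Longrightarrow> P u"
    and "\<And>v w. linked W u v \<Longrightarrow> P v \<Longrightarrow> z2_adj v w \<Longrightarrow> w \<in> W \<Longrightarrow> P w"
  shows "P v"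
proof -
  have u: "u \<in> W" and r: "(\<lambda>x y. z2_adj x y \<and> y \<in> W)\<^sup>*\<^sup>* u v"
    using assms(1) unfolding linked_def by auto
  from r have "linked W u v \<and> P v"
    by (induction rule: rtranclp_induct) (use u assms(2,3) in \<open>auto intro: linked_refl linked_step\<close>)
  then show ?thesis ..
qed

lemma linked_in: assumes "linked W u v" shows "u \<in> W" "v \<in> W"
  using assms by (auto simp: linked_def elim: rtranclp.cases)

lemma linked_trans: "linked W u v \<Longrightarrow> linked W v w \<Longrightarrow> linked W u w"
  unfolding linked_def by auto

lemma linked_sym: assumes "linked W u v" shows "linked W v u"
  using assms
proof (induction rule: linked_induct)
  case (step v w)
  then have "linked W w v" by (meson linked_in linked_refl linked_step z2_adj_sym)
  then show ?case using step.IH linked_trans by blast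
qed (rule linked_refl)

lemma linked_mono: assumes "linked W u v" "W \<subseteq> W'" shows "linked W' u v"
  using assms(1)
  by (induction rule: linked_induct) (use assms(2) in \<open>auto intro: linked_refl linked_step\<close>)

text \<open>Every prefix of a path from \<open>u\<close> links its end to \<open>u\<close>, so the
  path stays in the component of \<open>u\<close>.\<close>

lemma linked_within_class:
  assumes "linked W u v" shows "linked {x. linked W u x} u v"
  using assms
  by (induction rule: linked_induct) (auto intro: linked_refl linked_step)

lemma linked_class: 
  assumes "linked W u a" "linked W u b" shows "linked {x. linked W u x} a b"
  using linked_trans[OF linked_sym[OF linked_within_class[OF assms(1)]] linked_within_class[OF assms(2)]] .

text \<open>Induction on the l1-distance, moving \<open>v\<close> one unit towards \<open>u\<close>.
  The sides are only order-convex sets, so that half-planes are covered as well as segments.\<close>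

lemma linked_rectangle:
  assumes cx: "\<And>x y z. x \<in> A \<Longrightarrow> z \<in> A \<Longrightarrow> x \<le> y \<Longrightarrow> y \<le> z \<Longrightarrow> y \<in> A"
    and cy: "\<And>x y z. x \<in> B \<Longrightarrow> z \<in> B \<Longrightarrow> x \<le> y \<Longrightarrow> y \<le> z \<Longrightarrow> y \<in> B"
    and "u \<in> A \<times> B" "v \<in> A \<times> B"
  shows "linked (A \<times> B) u v"
proof -
  have *: "linked (A \<times> B) u v" if "u \<in> A \<times> B" "v \<in> A \<times> B" 
    "nat \<bar>fst u - fst v\<bar> + nat \<bar>snd u - snd v\<bar> = n" for n u v
    using that
  proof (induction n arbitrary: v)
    case 0
    then show ?case by (cases u; cases v) (auto intro: linked_refl)
  next
    case (Suc n)
    obtain u1 u2 v1 v2 where uv: "u = (u1,u2)" "v = (v1,v2)" by fastforce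
    define w where "w = (if u1 < v1 then (v1 - 1, v2) else if u1 > v1 then (v1+1,v2)
       else if u2 < v2 then (v1, v2 - 1) else (v1, v2+1))"
    have "w \<in> A \<times> B" using Suc.prems cx[of u1 v1 "v1-1"] cx[of v1 u1 "v1+1"] cy[of u2 v2 "v2-1"] cy[of v2 u2 "v2+1"]
      unfolding uv w_def by auto
    moreover have "nat \<bar>fst u - fst w\<bar> + nat \<bar>snd u - snd w\<bar> = n"
      using Suc.prems(3) unfolding uv w_def by auto
    ultimately have "linked (A \<times> B) u w" using Suc by blast
    moreover have "z2_adj w v" unfolding z2_adj_def w_def uv by auto
    ultimately show ?case using linked_step Suc.prems by blast
  qed
  show ?thesis using * assms(3,4) by blast
qed

section \<open>Primitives of closed 1-cochains on the lattice\<close>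

lemma int_primitive:
  fixes f :: "int \<Rightarrow> int"
  obtains F where "\<And>x. F (x + 1) - F x = f x"
proof
  define F where "F x = (\<Sum>i\<in>{0..<x}. f i) - (\<Sum>i\<in>{x..<0}. f i)" for x
  fix x
  show "F (x + 1) - F x = f x"
  proof (cases "x \<ge> 0")
    case True
    then have "{0..<x+1} = insert x {0..<x}" by auto
    with True show ?thesis by (simp add: F_def)
  next
    case False
    then have "{x..<0} = insert x {x+1..<0}" by auto
    with False show ?thesis by (simp add: F_def)
  qed
qed

text \<open>A discrete Poincare lemma: \<open>h\<close> and \<open>v\<close> live on horizontal and
  vertical edges, and \<open>closed\<close> says that the circulation around each unit square
  vanishes. Integrate along the axis \<open>y = 0\<close>, then vertically.\<close>

lemma z2_primitive:
  fixes h v :: "int \<Rightarrow> int \<Rightarrow> int"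
  assumes closed: "\<And>x y. h x y + v (x + 1) y = v x y + h x (y + 1)"
  obtains g where "\<And>x y. g (x + 1) y - g x y = h x y" "\<And>x y. g x (y + 1) - g x y = v x y"
proof -
  obtain A where A: "A (x + 1) - A x = h x 0" for x using int_primitive[of "\<lambda>x. h x 0"] by blast
  have "\<exists>F. \<forall>y. F (y + 1) - F y = v x y" for x using int_primitive[of "v x"] by metis
  then obtain B where B: "B x (y + 1) - B x y = v x y" for x y by metis
  define g where "g x y = A x + B x y - B x 0" for x y
  have gv: "g x (y + 1) - g x y = v x y" for x y using B[of x y] by (simp add: g_def)
  have "g (x + 1) y - g x y = h x y" for x y
  proof (induction y rule: int_induct[where k = 0])
    case base show ?case using A by (simp add: g_def)
  next
    case (step1 i)
    then show ?case using gv[of x i] gv[of "x+1" i] closed[of x i] by linarith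
  next
    case (step2 i)
    then show ?case using gv[of x "i-1"] gv[of "x+1" "i-1"] closed[of x "i-1"] by simp
  qed
  with gv show ?thesis using that by blast
qed

text \<open>If the part \<open>D1\<close> of the boundary were not king-adjacent to the rest \<open>D2\<close>, then counting the signed
  crossings of edges from \<open>K\<close> to \<open>D1\<close> would be a closed 1-cochain, since on every unit square it is
  either zero or the coboundary of the indicator of \<open>U\<close>. Its primitive is constant on \<open>K\<close> and
  on \<open>U\<close>, but jumps by 1 across \<open>D1\<close> and by 0 across \<open>D2\<close>.\<close>

lemma boundary_star_connected:
  assumes K: "\<And>a b. a \<in> K \<Longrightarrow> b \<in> K \<Longrightarrow> linked K a b"
    and U: "\<And>a b. a \<in> U \<Longrightarrow> b \<in> U \<Longrightarrow> linked U a b"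
    and disj: "U \<inter> K = {}"
    and closed: "\<And>a b. a \<in> U \<Longrightarrow> z2_adj a b \<Longrightarrow> b \<in> U \<union> K"
    and D: "D1 \<union> D2 = {u \<in> U. \<exists>a\<in>K. z2_adj a u}" "D1 \<inter> D2 = {}" "D1 \<noteq> {}" "D2 \<noteq> {}"
  shows "\<exists>x\<in>D1. \<exists>y\<in>D2. sup_dist x y \<le> 1"
proof (rule ccontr)
  assume "\<not> ?thesis"
  then have far: "x \<in> D1 \<Longrightarrow> y \<in> D2 \<Longrightarrow> sup_dist x y > 1" for x y by force
  define w :: "int \<times> int \<Rightarrow> int \<times> int \<Rightarrow> int" where "w a b = 
     (if a \<in> K \<and> b \<in> D1 then 1 else if a \<in> D1 \<and> b \<in> K then -1 else 0)" for a b
  define I :: "int \<times> int \<Rightarrow> int" where "I a = of_bool (a \<in> U)" for a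
  have DU: "D1 \<subseteq> U" using D by blast
  have wI: "w a b = I b - I a" if "z2_adj a b" "a \<notin> D2" "b \<notin> D2" for a b
  proof -
    have 1: "a \<in> K \<Longrightarrow> b \<in> U \<Longrightarrow> b \<in> D1" using D(1) that by blast
    have 2: "b \<in> K \<Longrightarrow> a \<in> U \<Longrightarrow> a \<in> D1" using D(1) that z2_adj_sym by blast
    have 3: "a \<in> U \<Longrightarrow> b \<in> U \<or> b \<in> K" "b \<in> U \<Longrightarrow> a \<in> U \<or> a \<in> K"
      using closed that z2_adj_sym by blast+
    show ?thesis using 1 2 3 DU disj unfolding w_def I_def by auto
  qed
  have w0: "w a b = 0" if "a \<notin> D1" "b \<notin> D1" for a b using that unfolding w_def by auto
  define h where "h x y = w (x,y) (x+1,y)" for x y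
  define v where "v x y = w (x,y) (x,y+1)" for x y
  \<comment> \<open>Corners of a unit square are within sup-distance 1, so a square that meets
    \<open>D2\<close> misses \<open>D1\<close> and carries weight 0; on the other squares
    \<open>wI\<close> applies.\<close>
  have cl: "h x y + v (x + 1) y = v x y + h x (y + 1)" for x y
  proof (cases "\<exists>q\<in>{(x,y),(x+1,y),(x,y+1),(x+1,y+1)}. q \<in> D2")
    case True
    then obtain q where q: "q\<in>{(x,y),(x+1,y),(x,y+1),(x+1,y+1)}" "q \<in> D2" by blast
    have "p \<notin> D1" if "p\<in>{(x,y),(x+1,y),(x,y+1),(x+1,y+1)}" for p
      using far[of p q] q that by (auto simp: sup_dist_def)
    then show ?thesis unfolding h_def v_def by (simp add: w0)
  next
    case False
    then show ?thesis unfolding h_def v_def by (simp add: wI z2_adj_def)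
  qed
  obtain g where g: "\<And>x y. g (x + 1) y - g x y = h x y" "\<And>x y. g x (y + 1) - g x y = v x y"
    using z2_primitive[of h v, OF cl] by blast
  define G where "G p = g (fst p) (snd p)" for p
  have wneg: "w b a = - w a b" for a b
    using disj DU by (auto simp: w_def)
  have G: "G b - G a = w a b" if ab: "z2_adj a b" for a b
  proof -
    obtain x y x' y' where e: "a = (x,y)" "b = (x',y')" by fastforce
    have "(x' = x+1 \<and> y' = y) \<or> (x' = x \<and> y' = y + 1) \<or> (x = x' + 1 \<and> y' = y) \<or> (x' = x \<and> y = y' + 1)"
      using ab unfolding e z2_adj_def by auto
    then show ?thesis using g(1)[of x y] g(2)[of x y] g(1)[of x' y'] g(2)[of x' y'] wneg[of a b]
      by (elim disjE) (auto simp: e G_def h_def v_def)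
  qed
  have cK: "G b = G a" if "linked K a b" for a b
    using that
  proof (induction rule: linked_induct)
    case (step v w')
    have "v \<in> K" using step linked_in by blast
    then have "w v w' = 0" using disj DU step by (auto simp: w_def)
    then show ?case using G[of v w'] step by simp
  qed simp
  have cU: "G b = G a" if "linked U a b" for a b
    using that
  proof (induction rule: linked_induct)
    case (step v w')
    have "v \<in> U" using step linked_in by blast
    then have "w v w' = 0" using disj step by (auto simp: w_def)
    then show ?case using G[of v w'] step by simp
  qed simp
  obtain x1 where x1: "x1 \<in> D1" using D by blast
  obtain x2 where x2: "x2 \<in> D2" using D by blast
  have x1U: "x1 \<in> U" using DU x1 by blast
  obtain a1 where a1: "a1 \<in> K" "z2_adj a1 x1" using D(1) x1 by blast
  have x2U: "x2 \<in> U" using D x2 by blast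
  obtain a2 where a2: "a2 \<in> K" "z2_adj a2 x2" using D(1) x2 by blast
  have "G x1 - G a1 = 1" using G[OF a1(2)] a1 x1 by (simp add: w_def)
  moreover have "G x2 - G a2 = 0" using G[OF a2(2)] a2 x2 x2U D disj by (auto simp: w_def)
  moreover have "G x1 = G x2" using cU U x1U x2U by metis
  moreover have "G a1 = G a2" using cK K a1 a2 by metis
  ultimately show False by simp
qed

section \<open>Long chordless paths in outer boundaries\<close>

definition chordless_path :: "nat \<Rightarrow> (nat \<Rightarrow> int \<times> int) \<Rightarrow> bool" where
  "chordless_path k p \<longleftrightarrow> (\<forall>i<k. diag_adj (p i) (p (Suc i))) \<and>
     (\<forall>i j. i < j \<longrightarrow> j \<le> k \<longrightarrow> p i \<noteq> p j \<and> (diag_adj (p i) (p j) \<longrightarrow> j = Suc i))"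

lemma diag_adj_of_sup_dist_le:
  assumes "u \<noteq> v" "\<not> z2_adj u v" "sup_dist u v \<le> 1" 
  shows "diag_adj u v"
proof -
  have "fst u \<noteq> fst v \<or> snd u \<noteq> snd v" using assms(1) by (simp add: prod_eq_iff)
  moreover have "\<bar>fst u - fst v\<bar> \<le> 1" "\<bar>snd u - snd v\<bar> \<le> 1" using assms(3) unfolding sup_dist_def by auto
  then have "\<bar>fst u - fst v\<bar> \<in> {0, 1}" "\<bar>snd u - snd v\<bar> \<in> {0, 1}" by auto
  ultimately show ?thesis using assms(2) unfolding z2_adj_def diag_adj_def by auto
qed

text \<open>A shortest diagonal path within \<open>D\<close> has no chords. Each step increases the
  sup-distance from \<open>s\<close> by at most 1, so there are at least \<open>k\<close> steps, and
  the first \<open>k\<close> of them form the required path.\<close>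

lemma shortest_chordless_path:
  assumes "(\<lambda>x y. diag_adj x y \<and> x \<in> D \<and> y \<in> D)\<^sup>*\<^sup>* s t" and s: "s \<in> D" and k: "int k \<le> sup_dist s t"
  obtains p where "chordless_path k p" "p 0 = s" "\<And>i. i \<le> k \<Longrightarrow> p i \<in> D"
proof -
  define R where "R = (\<lambda>x y. diag_adj x y \<and> x \<in> D \<and> y \<in> D)"
  define n where "n = (LEAST n. (R ^^ n) s t)"
  have "\<exists>n. (R ^^ n) s t" using rtranclp_imp_relpowp[OF assms(1)] unfolding R_def .
  then have n: "(R ^^ n) s t" unfolding n_def by (rule LeastI_ex)
  have min: "n \<le> m" if "(R ^^ m) s t" for m unfolding n_def using that by (rule Least_le)
  from n obtain f where f: "f 0 = s" "f n = t" "\<And>i. i < n \<Longrightarrow> R (f i) (f (Suc i))"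
    unfolding relpowp_fun_conv by blast
  have dist: "sup_dist s (f i) \<le> int i" if "i \<le> n" for i
    using that
  proof (induction i)
    case 0 then show ?case by (simp add: f sup_dist_def)
  next
    case (Suc i)
    then show ?case using f(3)[of i] unfolding R_def diag_adj_def sup_dist_def by auto
  qed
  have kn: "k \<le> n" using dist[of n] k f by simp
  have sub: "(R ^^ (j - i)) (f i) (f j)" if "i \<le> j" "j \<le> n" for i j
    unfolding relpowp_fun_conv by (rule exI[of _ "\<lambda>l. f (i + l)"]) (use f(3) that in auto)
  have short: "j = Suc i" if ij: "i < j" "j \<le> n" "R (f i) (f j)" for i j
  proof -
    have "(R ^^ (Suc i)) s (f j)" using sub[of 0 i] ij f(1) by (auto intro: relpowp_Suc_I)
    then have "(R ^^ (Suc i + (n - j))) s t" using relpowp_trans sub[OF ij(2) order_refl] f(2) by metis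
    then have "n \<le> Suc i + (n - j)" by (rule min)
    then show ?thesis using ij by linarith
  qed
  have ne: "f i \<noteq> f j" if ij: "i < j" "j \<le> n" for i j
  proof
    assume "f i = f j"
    then have "(R ^^ i) s (f j)" using sub[of 0 i] ij f(1) by auto
    then have "(R ^^ (i + (n - j))) s t" using relpowp_trans sub[OF ij(2) order_refl] f(2) by metis
    then have "n \<le> i + (n - j)" by (rule min)
    then show False using ij by linarith
  qed
  have fD: "f i \<in> D" if "i \<le> n" for i
    using that f(1) s f(3)[of "i-1"] unfolding R_def by (cases i) auto
  have "chordless_path k f"
    unfolding chordless_path_def
  proof (intro conjI allI impI)
    fix i assume "i < k"
    then show "diag_adj (f i) (f (Suc i))" using f(3)[of i] kn unfolding R_def by auto
  next
    fix i j assume "i < j" "j \<le> k"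
    then show "f i \<noteq> f j" using ne kn by auto
    assume "diag_adj (f i) (f j)"
    then show "j = Suc i" using short[of i j] fD[of i] fD[of j] \<open>i < j\<close> \<open>j \<le> k\<close> kn
      unfolding R_def by auto
  qed
  then show ?thesis using that f(1) fD kn by auto
qed

text \<open>\<open>U\<close> is the component of the complement of \<open>K\<close> that contains a
  point beyond the bounding box, and \<open>D\<close> is the outer boundary of \<open>K\<close>.
  Being star-connected, \<open>D\<close> is connected by diagonal steps, because points of
  \<open>S\<close> are never lattice-adjacent.\<close>

lemma enclosing_chordless_path:
  assumes fin: "finite K" and K: "\<And>a b. a \<in> K \<Longrightarrow> b \<in> K \<Longrightarrow> linked K a b"
    and bd: "\<And>a u. a \<in> K \<Longrightarrow> u \<notin> K \<Longrightarrow> z2_adj a u \<Longrightarrow> u \<in> S"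
    and indep: "\<And>x y. x \<in> S \<Longrightarrow> y \<in> S \<Longrightarrow> \<not> z2_adj x y"
    and ab: "a \<in> K" "b \<in> K" "int k \<le> sup_dist a b"
  shows "\<exists>p. chordless_path k p \<and> (\<forall>i\<le>k. p i \<in> S) \<and> (\<exists>c\<in>K. z2_adj c (p 0))"
proof -
  define X where "X = fst ` K"
  define Y where "Y = snd ` K"
  have finXY: "finite X" "finite Y" "X \<noteq> {}" "Y \<noteq> {}" using fin ab by (auto simp: X_def Y_def)
  define p0 where "p0 = (Max X + 1, Max Y + 1)"
  have inX: "fst c \<in> X" "fst c \<le> Max X" "Min X \<le> fst c" and inY: "snd c \<in> Y" "snd c \<le> Max Y" "Min Y \<le> snd c" 
    if "c \<in> K" for c using that finXY by (auto simp: X_def Y_def)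
  define U where "U = {u. linked (-K) p0 u}"
  define D where "D = {u \<in> U. \<exists>a\<in>K. z2_adj a u}"
  have Kout: "(x,y) \<notin> K" if "x > Max X \<or> x < Min X \<or> y > Max Y \<or> y < Min Y" for x y
    using inX[of "(x,y)"] inY[of "(x,y)"] that by auto
  have half: "linked (-K) u v" if "u \<in> A \<times> B" "v \<in> A \<times> B" "A \<times> B \<subseteq> -K"
     "\<And>x y z. x \<in> A \<Longrightarrow> z \<in> A \<Longrightarrow> x \<le> y \<Longrightarrow> y \<le> z \<Longrightarrow> y \<in> A"
     "\<And>x y z. x \<in> B \<Longrightarrow> z \<in> B \<Longrightarrow> x \<le> y \<Longrightarrow> y \<le> z \<Longrightarrow> y \<in> B" for u v A B
    using linked_mono[OF linked_rectangle[of A B u v]] that by blast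
  \<comment> \<open>The half-planes beyond the four sides of the bounding box avoid \<open>K\<close>
    and overlap in turn, so all of them lie in \<open>U\<close>.\<close>
  have top: "(x,y) \<in> U" if "y > Max Y" for x y
    unfolding U_def using half[of p0 UNIV "{Max Y<..}" "(x,y)"] Kout that by (auto simp: p0_def)
  have right: "(x,y) \<in> U" if "x > Max X" for x y
    unfolding U_def using half[of p0 "{Max X<..}" UNIV "(x,y)"] Kout that by (auto simp: p0_def)
  have left: "(x,y) \<in> U" if "x < Min X" for x y
  proof -
    have "linked (-K) (Min X - 1, Max Y + 1) (x,y)"
      using half[of "(Min X - 1, Max Y + 1)" "{..<Min X}" UNIV "(x,y)"] Kout that by auto
    then show ?thesis using top[of "Max Y + 1" "Min X - 1"] linked_trans unfolding U_def by auto
  qed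
  have bot: "(x,y) \<in> U" if "y < Min Y" for x y
  proof -
    have "linked (-K) (Max X + 1, Min Y - 1) (x,y)"
      using half[of "(Max X + 1, Min Y - 1)" UNIV "{..<Min Y}" "(x,y)"] Kout that by auto
    then show ?thesis using right[of "Max X + 1" "Min Y - 1"] linked_trans unfolding U_def by auto
  qed
  have disj: "U \<inter> K = {}" unfolding U_def using linked_in by blast
  have DS: "D \<subseteq> S" using bd disj unfolding D_def by blast
  have star: "(\<lambda>x y. diag_adj x y \<and> x \<in> D \<and> y \<in> D)\<^sup>*\<^sup>* s t" if s: "s \<in> D" and t: "t \<in> D" for s t
  proof (rule ccontr)
    assume neg: "\<not> ?thesis"
    \<comment> \<open>If \<open>t\<close> is not reached, the diagonal component of \<open>s\<close>
      splits \<open>D\<close> into two nonempty parts; these come within sup-distance 1, which gives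
      a diagonal step out of the component.\<close>
    define D1 where "D1 = {x. (\<lambda>x y. diag_adj x y \<and> x \<in> D \<and> y \<in> D)\<^sup>*\<^sup>* s x}"
    have D1: "D1 \<subseteq> D" unfolding D1_def using s by (auto elim: rtranclp.cases)
    have "\<exists>x\<in>D1. \<exists>y\<in>D - D1. sup_dist x y \<le> 1"
    proof (rule boundary_star_connected[OF K _ disj])
      show "linked U a b" if "a \<in> U" "b \<in> U" for a b
        using that linked_class[of "-K" p0 a b] unfolding U_def by blast
      show "b \<in> U \<union> K" if "a \<in> U" "z2_adj a b" for a b
        using that linked_step unfolding U_def by blast
      show "D1 \<union> (D - D1) = {u \<in> U. \<exists>a\<in>K. z2_adj a u}" using D1 unfolding D_def by blast
      show "D1 \<noteq> {}" unfolding D1_def by blast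
      show "D - D1 \<noteq> {}" using t neg unfolding D1_def by blast
    qed auto
    then obtain x y where xy: "x \<in> D1" "y \<in> D" "y \<notin> D1" "sup_dist x y \<le> 1" by blast
    have "x \<noteq> y" using xy by blast
    moreover have "\<not> z2_adj x y" using indep[of x y] xy D1 DS by blast
    ultimately have "diag_adj x y"
      using xy(4) by (rule diag_adj_of_sup_dist_le)
    then have "y \<in> D1" using xy D1 unfolding D1_def by (auto intro: rtranclp.rtrancl_into_rtrancl)
    then show False using xy by blast
  qed
  \<comment> \<open>In a coordinate in which \<open>a\<close> and \<open>b\<close> differ by at
    least \<open>k\<close>, take extreme points of \<open>K\<close>; the lattice points just beyond
    them belong to \<open>D\<close>.\<close>
  have "\<exists>s t. s \<in> D \<and> t \<in> D \<and> int k \<le> sup_dist s t"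
  proof (cases "\<bar>fst a - fst b\<bar> \<ge> int k")
    case True
    obtain c where c: "c \<in> K" "fst c = Max X" using Max_in[OF finXY(1,3)] unfolding X_def by auto
    obtain d where d: "d \<in> K" "fst d = Min X" using Min_in[OF finXY(1,3)] unfolding X_def by auto
    have "(fst c + 1, snd c) \<in> D" using right[of "fst c + 1" "snd c"] c
      unfolding D_def by (auto simp: z2_adj_def intro!: bexI[of _ c])
    moreover have "(fst d - 1, snd d) \<in> D" using left[of "fst d - 1" "snd d"] d
      unfolding D_def by (auto simp: z2_adj_def intro!: bexI[of _ d])
    moreover have "int k \<le> sup_dist (fst c + 1, snd c) (fst d - 1, snd d)"
      using True inX[OF ab(1)] inX[OF ab(2)] c(2) d(2) unfolding sup_dist_def fst_conv snd_conv by linarith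
    ultimately show ?thesis by blast
  next
    case False
    then have k: "\<bar>snd a - snd b\<bar> \<ge> int k" using ab(3) unfolding sup_dist_def by linarith
    obtain c where c: "c \<in> K" "snd c = Max Y" using Max_in[OF finXY(2,4)] unfolding Y_def by auto
    obtain d where d: "d \<in> K" "snd d = Min Y" using Min_in[OF finXY(2,4)] unfolding Y_def by auto
    have "(fst c, snd c + 1) \<in> D" using top[of "snd c + 1" "fst c"] c
      unfolding D_def by (auto simp: z2_adj_def intro!: bexI[of _ c])
    moreover have "(fst d, snd d - 1) \<in> D" using bot[of "snd d - 1" "fst d"] d
      unfolding D_def by (auto simp: z2_adj_def intro!: bexI[of _ d])
    moreover have "int k \<le> sup_dist (fst c, snd c + 1) (fst d, snd d - 1)"
      using k inY[OF ab(1)] inY[OF ab(2)] c(2) d(2) unfolding sup_dist_def fst_conv snd_conv by linarith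
    ultimately show ?thesis by blast
  qed
  then obtain s t where st: "s \<in> D" "t \<in> D" "int k \<le> sup_dist s t" by blast
  obtain p where "chordless_path k p" "p 0 = s" "\<And>i. i \<le> k \<Longrightarrow> p i \<in> D"
    using shortest_chordless_path[OF star[OF st(1,2)] st(1,3)] by blast
  then show ?thesis using DS st(1) unfolding D_def by blast
qed

section \<open>The first four layers and local maxima\<close>

definition loc_max :: "(int \<times> int \<Rightarrow> real) \<Rightarrow> (int \<times> int) set" where
  "loc_max age = {x. \<forall>u. z2_adj u x \<longrightarrow> age u < age x}"

definition grid :: "nat \<Rightarrow> (int \<times> int) set" where
  "grid n = {- int n..int n} \<times> {- int n..int n}"

definition linked_classes :: "(int \<times> int) set \<Rightarrow> (int \<times> int) set set" where
  "linked_classes W = {{y. linked W x y} |x. x \<in> W}"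

text \<open>The adjacency is symmetric, so mutual reachability is just reachability, and both are
  \<open>linked W\<close>.\<close>

lemma graph_components_eq:
  assumes "verts G = W" and "arcs_ends G = {(u, v). u \<in> W \<and> v \<in> W \<and> z2_adj u v}"
  shows "graph_components G = linked_classes W"
proof -
  have r: "u \<rightarrow>\<^sup>*\<^bsub>G\<^esub> v \<longleftrightarrow> linked W u v" for u v
  proof
    assume "u \<rightarrow>\<^sup>*\<^bsub>G\<^esub> v"
    then have "(u, v) \<in> rtrancl_on W (arcs_ends G)" unfolding reachable_def assms(1) .
    then show "linked W u v"
      by (induction rule: rtrancl_on_induct) (auto simp: assms(2) intro: linked_refl linked_step)
  next
    assume "linked W u v"
    then have "(u, v) \<in> rtrancl_on W (arcs_ends G)"
    proof (induction rule: linked_induct)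
      case (step v w)
      then show ?case using linked_in[OF step(1)] 
        by (auto simp: assms(2) intro: rtrancl_on_into_rtrancl_on[of u v])
    qed simp
    then show "u \<rightarrow>\<^sup>*\<^bsub>G\<^esub> v" unfolding reachable_def assms(1) .
  qed
  show ?thesis
  proof (intro Set.equalityI subsetI)
    fix K assume "K \<in> graph_components G"
    then have K0: "K \<noteq> {}" "\<forall>u\<in>K. \<forall>v\<in>K. linked W u v"
      "\<forall>u\<in>K. \<forall>v. v \<notin> K \<longrightarrow> \<not> linked W u v \<or> \<not> linked W v u"
      unfolding pre_digraph.sccs_verts_def r by simp_all
    have K: "u \<in> K \<Longrightarrow> v \<in> K \<Longrightarrow> linked W u v" for u v using K0(2) by blast
    have K': "v \<in> K" if "u \<in> K" "linked W u v" for u v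
      using K0(3)[rule_format, of u v] linked_sym[of W u v] that by blast
    from K0(1) obtain u where u: "u \<in> K" by blast
    then have "K = {y. linked W u y}" using K K' by blast
    moreover have "u \<in> W" using K[OF u u] linked_in(1) by blast
    ultimately show "K \<in> linked_classes W" unfolding linked_classes_def by blast
  next
    fix K assume "K \<in> linked_classes W"
    then obtain u where u: "u \<in> W" "K = {y. linked W u y}" unfolding linked_classes_def by blast
    have "u \<in> K" using u linked_refl by blast
    moreover have "linked W a b" if "a \<in> K" "b \<in> K" for a b
      using that u linked_trans[OF linked_sym] by blast
    moreover have "b \<in> K" if "a \<in> K" "linked W a b" for a b
      using that u linked_trans by blast
    ultimately have "K \<noteq> {} \<and> (\<forall>u\<in>K. \<forall>v\<in>K. linked W u v) \<and>
      (\<forall>u\<in>K. \<forall>v. v \<notin> K \<longrightarrow> \<not> linked W u v \<or> \<not> linked W v u)" by blast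
    then show "K \<in> graph_components G"
      unfolding pre_digraph.sccs_verts_def r by simp
  qed
qed

lemma verts_z2_graph: "verts z2_graph = UNIV" and arcs_z2_graph: "arcs z2_graph = {(u, v). z2_adj u v}"
  and tail_z2_graph: "tail z2_graph = fst" and head_z2_graph: "head z2_graph = snd"
  by (simp_all add: z2_graph_def with_proj_def z2_adj_def)

lemma arcs_ends_induced_z2_graph:
  "arcs_ends (z2_graph \<restriction> W) = {(u, v). u \<in> W \<and> v \<in> W \<and> z2_adj u v}"
  by (auto simp: arcs_ends_def arc_to_ends_def arcs_z2_graph tail_z2_graph head_z2_graph)

lemma arcs_ends_z2_graph: "arcs_ends z2_graph = {(u, v). z2_adj u v}"
  by (auto simp: arcs_ends_def arc_to_ends_def arcs_z2_graph tail_z2_graph head_z2_graph)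

lemma induce_induce_subgraph: "A \<subseteq> B \<Longrightarrow> (G \<restriction> B) \<restriction> A = G \<restriction> A"
  by (auto simp: induce_subgraph_def)

lemma z2_neighbours:
  "{u. z2_adj u (x, y)} = {(x + 1, y), (x - 1, y), (x, y + 1), (x, y - 1)}"
  by (auto simp: z2_adj_def)

lemma finite_z2_neighbours [simp]: "finite {u. z2_adj u v}"
  by (cases v) (simp add: z2_neighbours)

lemma card_z2_neighbours: "card {u. z2_adj u v} = 4"
  by (cases v) (simp add: z2_neighbours)

lemma first_layers_eq:
  assumes "\<And>u v. v \<in> verts G \<Longrightarrow> u \<rightarrow>\<^bsub>G\<^esub> v \<longleftrightarrow> u \<in> verts G \<and> z2_adj u v"
  shows "(\<Union>i\<in>{1..4}. layer G age i) = 
     verts G - {v \<in> loc_max age. {u. z2_adj u v} \<subseteq> verts G}"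
proof -
  have "(\<exists>i\<in>{1..4}. card {u. u \<rightarrow>\<^bsub>G\<^esub> v \<and> age u < age v} = i - 1) \<longleftrightarrow> 
     \<not> (v \<in> loc_max age \<and> {u. z2_adj u v} \<subseteq> verts G)" if v: "v \<in> verts G" for v
  proof -
    let ?A = "{u. u \<rightarrow>\<^bsub>G\<^esub> v \<and> age u < age v}"
    have A: "?A = {u. z2_adj u v \<and> u \<in> verts G \<and> age u < age v}" using assms[OF v] by auto
    have sub: "?A \<subseteq> {u. z2_adj u v}" using A by auto
    \<comment> \<open>Layers 1 to 4 stand for the counts 0 to 3, and no count exceeds 4.\<close>
    have "(\<exists>i\<in>{1..4}. card ?A = i - 1) \<longleftrightarrow> card ?A \<noteq> 4"
      using card_mono[OF finite_z2_neighbours sub] unfolding card_z2_neighbours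
      by (auto intro!: bexI[of _ "Suc (card ?A)"])
    also have "card ?A = 4 \<longleftrightarrow> ?A = {u. z2_adj u v}"
    proof
      assume "card ?A = 4"
      then show "?A = {u. z2_adj u v}"
        by (intro card_subset_eq sub finite_z2_neighbours) (simp only: card_z2_neighbours)
    qed (simp only: card_z2_neighbours)
    also have "\<dots> \<longleftrightarrow> v \<in> loc_max age \<and> {u. z2_adj u v} \<subseteq> verts G"
      unfolding A loc_max_def by blast
    finally show ?thesis by blast
  qed
  then show ?thesis unfolding layer_def by blast
qed

lemma graph_components_z2: 
  "graph_components (first_layers z2_graph age 4) = linked_classes (- loc_max age)"
proof (rule graph_components_eq)
  have "(\<Union>i\<in>{1..4}. layer z2_graph age i) = - loc_max age"
    by (subst first_layers_eq) (auto simp: verts_z2_graph arcs_ends_z2_graph)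
  then show "verts (first_layers z2_graph age 4) = - loc_max age"
    "arcs_ends (first_layers z2_graph age 4) = 
        {(u, v). u \<in> - loc_max age \<and> v \<in> - loc_max age \<and> z2_adj u v}"
    by (simp_all add: first_layers_def arcs_ends_induced_z2_graph)
qed

text \<open>Vertices on the boundary of the box have at most three neighbours and are never deleted.\<close>

definition grid_layers :: "nat \<Rightarrow> (int \<times> int \<Rightarrow> real) \<Rightarrow> (int \<times> int) set" where
  "grid_layers n age = grid n - loc_max age \<inter> grid (n - 1)"

text \<open>For \<open>n = 0\<close> this fails: truncated subtraction makes
  \<open>grid (n - 1)\<close> the single point again.\<close>

lemma interior_grid:
  assumes "n \<ge> 1" 
  shows "{u. z2_adj u v} \<subseteq> grid n \<longleftrightarrow> v \<in> grid (n - 1)"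
proof (cases v)
  case (Pair x y)
  show ?thesis unfolding Pair z2_neighbours using assms by (auto simp: grid_def)
qed

lemma graph_components_box: 
  assumes "n \<ge> 1"
  shows "graph_components (first_layers (box_graph n) age 4) = linked_classes (grid_layers n age)"
proof (rule graph_components_eq)
  have G: "box_graph n = z2_graph \<restriction> grid n" by (simp add: box_graph_def grid_def)
  have *: "(\<Union>i\<in>{1..4}. layer (box_graph n) age i) = grid_layers n age"
    unfolding grid_layers_def
    by (subst first_layers_eq) (auto simp: G arcs_ends_induced_z2_graph interior_grid[OF assms])
  then show "verts (first_layers (box_graph n) age 4) = grid_layers n age"
    by (simp add: first_layers_def)
  have "first_layers (box_graph n) age 4 = z2_graph \<restriction> grid_layers n age"
    unfolding first_layers_def * unfolding G
    by (rule induce_induce_subgraph) (auto simp: grid_layers_def)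
  then show "arcs_ends (first_layers (box_graph n) age 4) = 
        {(u, v). u \<in> grid_layers n age \<and> v \<in> grid_layers n age \<and> z2_adj u v}"
    by (simp add: arcs_ends_induced_z2_graph)
qed

lemma finite_grid [simp]: "finite (grid n)" by (simp add: grid_def)

lemma card_grid: "card (grid n) = (2 * n + 1)\<^sup>2"
proof -
  have "card {- int n..int n} = 2 * n + 1" by simp
  then show ?thesis unfolding grid_def card_cartesian_product power2_eq_square by metis
qed

lemma loc_max_indep:
  assumes "x \<in> loc_max age" "y \<in> loc_max age" shows "\<not> z2_adj x y"
proof
  assume "z2_adj x y"
  then have "age x < age y" "age y < age x" 
    using assms z2_adj_sym unfolding loc_max_def by blast+
  then show False by simp
qed

section \<open>Components of the box\<close>

definition long_path :: "nat \<Rightarrow> nat \<Rightarrow> (int \<times> int) set \<Rightarrow> bool" where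
  "long_path k n S \<longleftrightarrow> (\<exists>p. chordless_path k p \<and> (\<forall>i\<le>k. p i \<in> S) \<and> p 0 \<in> grid n)"

text \<open>If \<open>K\<close> misses the boundary of the box, all lattice neighbours of
  \<open>K\<close> lie in the box, so those outside \<open>K\<close> were deleted and are local
  maxima. An extent of \<open>k\<close> would then force a chordless path of \<open>k\<close> steps
  through them.\<close>

lemma linked_class_dichotomy:
  assumes n: "n \<ge> 1" and np: "\<not> long_path k n (loc_max age)" 
    and K: "K \<in> linked_classes (grid_layers n age)"
  shows "\<not> K \<subseteq> grid (n - 1) \<or> (\<forall>a\<in>K. \<forall>b\<in>K. sup_dist a b < int k)"
proof (rule ccontr)
  assume "\<not> ?thesis"
  then obtain a b where K1: "K \<subseteq> grid (n - 1)" and ab: "a \<in> K" "b \<in> K" "int k \<le> sup_dist a b"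
    by force
  obtain x where x: "K = {y. linked (grid_layers n age) x y}" using K unfolding linked_classes_def by blast
  have Kn: "u \<in> grid n" if "a \<in> K" "z2_adj a u" for a u
    using interior_grid[OF n, of a] K1 that z2_adj_sym by blast
  have "\<exists>p. chordless_path k p \<and> (\<forall>i\<le>k. p i \<in> loc_max age) \<and> (\<exists>c\<in>K. z2_adj c (p 0))"
  proof (rule enclosing_chordless_path[OF _ _ _ _ ab])
    show "finite K" using K1 finite_subset by (metis finite_grid)
    show "linked K a b" if "a \<in> K" "b \<in> K" for a b
      using that linked_class unfolding x by simp
    show "u \<in> loc_max age" if "a \<in> K" "u \<notin> K" "z2_adj a u" for a u
    proof -
      have "u \<notin> grid_layers n age" using that linked_step unfolding x by blast
      then show ?thesis using Kn that unfolding grid_layers_def by blast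
    qed
    show "\<not> z2_adj x y" if "x \<in> loc_max age" "y \<in> loc_max age" for x y using loc_max_indep that .
  qed
  then show False using np Kn unfolding long_path_def by blast
qed

text \<open>Each side of the box is a degenerate rectangle that is never deleted. From the corner
  \<open>(int n, int n)\<close> the right and top sides are reached directly, the others through one
  further corner.\<close>

lemma linked_boundary:
  assumes n: "n \<ge> 1" and u: "u \<in> grid n - grid (n - 1)"
  shows "linked (grid_layers n age) (int n, int n) u"
proof -
  have ring: "grid n - grid (n - 1) \<subseteq> grid_layers n age" unfolding grid_layers_def by blast
  have conv: "y \<in> A" if "A \<in> {{- int n..int n}, {int n}, {- int n}}" "x \<in> A" "z \<in> A" "x \<le> y" "y \<le> z"
    for A :: "int set" and x y z
    using that by auto
  have side: "linked (grid_layers n age) s t" if "s \<in> A \<times> B" "t \<in> A \<times> B" "A \<times> B \<subseteq> grid n - grid (n - 1)"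
    "A \<in> {{- int n..int n}, {int n}, {- int n}}" "B \<in> {{- int n..int n}, {int n}, {- int n}}" for s t A B
  proof -
    have "linked (A \<times> B) s t"
      using conv[OF that(4)] conv[OF that(5)] that(1,2) by (rule linked_rectangle)
    then show ?thesis using that(3) ring by (blast intro: linked_mono)
  qed
  have sub: "{- int n..int n} \<times> {c} \<subseteq> grid n - grid (n - 1)" "{c} \<times> {- int n..int n} \<subseteq> grid n - grid (n - 1)"
    if "c \<in> {int n, - int n}" for c
    using that n by (auto simp: grid_def)
  have h: "linked (grid_layers n age) s t" 
    if "c \<in> {int n, - int n}" "s \<in> {- int n..int n} \<times> {c}" "t \<in> {- int n..int n} \<times> {c}" for s t c
    using side[OF that(2,3) sub(1)[OF that(1)]] that(1) by auto
  have v: "linked (grid_layers n age) s t" 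
    if "c \<in> {int n, - int n}" "s \<in> {c} \<times> {- int n..int n}" "t \<in> {c} \<times> {- int n..int n}" for s t c
    using side[OF that(2,3) sub(2)[OF that(1)]] that(1) by auto
  obtain x y where xy: "u = (x,y)" by fastforce
  have r: "x \<in> {- int n..int n}" "y \<in> {- int n..int n}" "x = int n \<or> x = - int n \<or> y = int n \<or> y = - int n"
    using u n unfolding xy grid_def by auto
  have c1: "linked (grid_layers n age) (int n, int n) (- int n, int n)" by (rule h[of "int n"]) auto
  have c2: "linked (grid_layers n age) (int n, int n) (int n, - int n)" by (rule v[of "int n"]) auto
  from r(3) show ?thesis
  proof (elim disjE)
    assume "x = int n"
    then show ?thesis using r unfolding xy by (intro v[of "int n"]) auto
  next
    assume "x = - int n"
    then show ?thesis using r unfolding xy by (intro linked_trans[OF c1] v[of "- int n"]) auto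
  next
    assume "y = int n"
    then show ?thesis using r unfolding xy by (intro h[of "int n"]) auto
  next
    assume "y = - int n"
    then show ?thesis using r unfolding xy by (intro linked_trans[OF c2] h[of "- int n"]) auto
  qed
qed

definition outer_component :: "nat \<Rightarrow> (int \<times> int \<Rightarrow> real) \<Rightarrow> (int \<times> int) set" where
  "outer_component n age = {y. linked (grid_layers n age) (int n, int n) y}"

lemma ring_subset_outer_component:
  "n \<ge> 1 \<Longrightarrow> grid n - grid (n - 1) \<subseteq> outer_component n age"
  unfolding outer_component_def using linked_boundary by blast

lemma outer_component_subset: "outer_component n age \<subseteq> grid n"
  unfolding outer_component_def using linked_in(2) unfolding grid_layers_def by blast

lemma outer_component_in_classes:
  assumes "n \<ge> 1" shows "outer_component n age \<in> linked_classes (grid_layers n age)"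
proof -
  have "(int n, int n) \<in> grid_layers n age" using assms by (auto simp: grid_layers_def grid_def)
  then show ?thesis unfolding outer_component_def linked_classes_def by blast
qed

lemma linked_classes_disjoint:
  assumes "K \<in> linked_classes W" "K' \<in> linked_classes W" "x \<in> K" "x \<in> K'"
  shows "K = K'"
proof -
  obtain a b where "K = {y. linked W a y}" "K' = {y. linked W b y}"
    using assms(1,2) unfolding linked_classes_def by blast
  moreover from this have "linked W a b" 
    using assms(3,4) linked_trans[OF _ linked_sym, of W a x b] by blast
  ultimately show ?thesis using linked_trans[of W] linked_sym[of W a b] by blast
qed

lemma other_component_small:
  assumes "n \<ge> 1" "\<not> long_path k n (loc_max age)" 
    "K \<in> linked_classes (grid_layers n age)" "K \<noteq> outer_component n age" "a \<in> K" "b \<in> K"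
  shows "sup_dist a b < int k"
proof -
  have "K \<subseteq> grid n" using assms(3) linked_in(2) unfolding linked_classes_def grid_layers_def by blast
  moreover have "K \<inter> outer_component n age = {}"
    using linked_classes_disjoint[OF assms(3) outer_component_in_classes[OF assms(1)]] assms(4) by blast
  ultimately have "K \<subseteq> grid (n - 1)" using ring_subset_outer_component[OF assms(1)] by blast
  then show ?thesis using linked_class_dichotomy[OF assms(1-3)] assms(5,6) by blast
qed

lemma card_sup_dist_le:
  assumes "\<And>a b. a \<in> K \<Longrightarrow> b \<in> K \<Longrightarrow> sup_dist a b \<le> int k"
  shows "card K \<le> (2 * k + 1)\<^sup>2"
proof (cases "K = {}")
  case False
  then obtain c where c: "c \<in> K" by blast
  let ?R = "{fst c - int k..fst c + int k} \<times> {snd c - int k..snd c + int k}"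
  have "K \<subseteq> ?R"
  proof
    fix b assume "b \<in> K"
    then have "sup_dist c b \<le> int k" using assms c by blast
    then show "b \<in> ?R" unfolding sup_dist_def by (cases b) auto
  qed
  then have "card K \<le> card ?R" by (intro card_mono) auto
  moreover have "card {c - int k..c + int k} = 2 * k + 1" for c by simp
  then have "card ?R = (2 * k + 1)\<^sup>2"
    unfolding card_cartesian_product power2_eq_square by metis
  ultimately show ?thesis by simp
qed simp

text \<open>The Euclidean norm is at most the sum of the absolute coordinates, hence the factor
  2.\<close>

lemma z2_diameter_le:
  assumes "\<And>a b. a \<in> K \<Longrightarrow> b \<in> K \<Longrightarrow> sup_dist a b \<le> int k"
  shows "z2_diameter K \<le> 2 * real k"
  unfolding z2_diameter_def
proof (rule diameter_le)
  fix x y assume "x \<in> (\<lambda>(x, y). (real_of_int x, real_of_int y)) ` K"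
    "y \<in> (\<lambda>(x, y). (real_of_int x, real_of_int y)) ` K"
  then obtain a b c d where ab: "x = (real_of_int a, real_of_int b)" "y = (real_of_int c, real_of_int d)"
    "(a, b) \<in> K" "(c, d) \<in> K" by auto
  have "\<bar>a - c\<bar> \<le> int k" "\<bar>b - d\<bar> \<le> int k" using assms[OF ab(3,4)] by (auto simp: sup_dist_def)
  then have "real_of_int \<bar>a - c\<bar> \<le> real k" "real_of_int \<bar>b - d\<bar> \<le> real k"
    by (metis of_int_le_iff of_int_of_nat_eq)+
  then show "norm (x - y) \<le> 2 * real k"
    using norm_Pair_le[of "real_of_int a - real_of_int c" "real_of_int b - real_of_int d"]
    unfolding ab by simp
qed simp

lemma card_outer_component_ge:
  assumes "n \<ge> 1" shows "2 * n + 1 \<le> card (outer_component n age)"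
proof -
  have "{- int n..int n} \<times> {int n} \<subseteq> grid n - grid (n - 1)" using assms by (auto simp: grid_def)
  then have "{- int n..int n} \<times> {int n} \<subseteq> outer_component n age"
    using ring_subset_outer_component[OF assms] by blast
  then have "card ({- int n..int n} \<times> {int n}) \<le> card (outer_component n age)"
    by (intro card_mono finite_subset[OF outer_component_subset]) auto
  then show ?thesis by (simp add: card_cartesian_product)
qed

text \<open>The hypothesis \<open>kn\<close> identifies \<open>GC\<close>: the outer component has
  at least \<open>2 * n + 1\<close> vertices, every other one at most
  \<open>(2 * k + 1)\<^sup>2\<close>.\<close>

lemma small_components:
  assumes n: "n \<ge> 1" and np: "\<not> long_path k n (loc_max age)" and kn: "(2 * k + 1)\<^sup>2 < 2 * n + 1"
    and GC: "largest_component (first_layers (box_graph n) age 4) GC"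
    and K: "K \<in> graph_components (first_layers (box_graph n) age 4)" "K \<noteq> GC"
  shows "z2_diameter K \<le> 2 * real k"
proof -
  have small: "sup_dist a b \<le> int k" if "K \<in> linked_classes (grid_layers n age)" "K \<noteq> outer_component n age" 
     "a \<in> K" "b \<in> K" for K a b
    using other_component_small[OF n np that] by simp
  have "GC \<in> linked_classes (grid_layers n age)" "card (outer_component n age) \<le> card GC"
    using GC outer_component_in_classes[OF n] 
    unfolding largest_component_def graph_components_box[OF n] by auto
  then have "GC = outer_component n age"
    using card_sup_dist_le[of GC k] small card_outer_component_ge[OF n, of age] kn by force
  then show ?thesis using K small unfolding graph_components_box[OF n] by (intro z2_diameter_le) auto
qed

text \<open>The path must stay in the ball of radius \<open>r\<close>. This makes the event local:
  with \<open>S = loc_max age\<close> it depends only on the ages within distance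
  \<open>r + 1\<close> of \<open>v\<close>.\<close>

definition reaches :: "nat \<Rightarrow> (int \<times> int) set \<Rightarrow> int \<times> int \<Rightarrow> bool" where
  "reaches r S v \<longleftrightarrow> (\<exists>z. linked ({u. sup_dist v u \<le> int r} - S) v z \<and> sup_dist v z = int r)"

text \<open>Inside the box \<open>v\<close> is linked to a point at distance \<open>r\<close>,
  whereas every component other than the outer one has extent less than \<open>r\<close>.\<close>

lemma reaches_in_outer_component:
  assumes n: "n \<ge> 1" and np: "\<not> long_path r n (loc_max age)" and v: "{u. sup_dist v u \<le> int r} \<subseteq> grid n" 
    and rv: "reaches r (loc_max age) v"
  shows "v \<in> outer_component n age"
proof -
  obtain z where z: "linked ({u. sup_dist v u \<le> int r} - loc_max age) v z" "sup_dist v z = int r"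
    using rv unfolding reaches_def by blast
  have l: "linked (grid_layers n age) v z"
    by (rule linked_mono[OF z(1)]) (use v in \<open>auto simp: grid_layers_def\<close>)
  let ?K = "{y. linked (grid_layers n age) v y}"
  have K: "?K \<in> linked_classes (grid_layers n age)" using linked_in(1)[OF l] unfolding linked_classes_def by blast
  have vz: "v \<in> ?K" "z \<in> ?K" using l linked_refl[OF linked_in(1)[OF l]] by auto
  then have "?K = outer_component n age"
    using other_component_small[OF n np K _ vz] z(2) by fastforce
  then show ?thesis using vz(1) by blast
qed

lemma largest_component_ge:
  assumes n: "n \<ge> 1" and np: "\<not> long_path r n (loc_max age)"
    and GC: "largest_component (first_layers (box_graph n) age 4) GC"
    and A: "\<And>v. v \<in> A \<Longrightarrow> {u. sup_dist v u \<le> int r} \<subseteq> grid n"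
  shows "card {v \<in> A. reaches r (loc_max age) v} \<le> card GC"
proof -
  have "card (outer_component n age) \<le> card GC"
    using GC outer_component_in_classes[OF n] 
    unfolding largest_component_def graph_components_box[OF n] by auto
  moreover have "card {v \<in> A. reaches r (loc_max age) v} \<le> card (outer_component n age)"
    using reaches_in_outer_component[OF n np] A
    by (intro card_mono finite_subset[OF outer_component_subset]) auto
  ultimately show ?thesis by linarith
qed

lemma sup_dist_step:
  assumes "z2_adj y w" shows "sup_dist v w \<le> sup_dist v y + 1"
proof -
  have "\<bar>fst y - fst w\<bar> \<le> 1" "\<bar>snd y - snd w\<bar> \<le> 1" using assms unfolding z2_adj_def by auto
  then have "\<bar>fst v - fst w\<bar> \<le> \<bar>fst v - fst y\<bar> + 1" "\<bar>snd v - snd w\<bar> \<le> \<bar>snd v - snd y\<bar> + 1" by auto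
  then show ?thesis unfolding sup_dist_def by auto
qed

text \<open>An infinite component leaves the finite ball. The distance from \<open>v\<close> grows
  by at most 1 per step, so the path meets the sphere of radius \<open>r\<close> before it
  leaves.\<close>

lemma linked_infinite_reaches:
  assumes "infinite {y. linked (- S) v y}"
  shows "reaches r S v"
proof -
  let ?B = "{u. sup_dist v u \<le> int r}"
  have "?B \<subseteq> {fst v - int r..fst v + int r} \<times> {snd v - int r..snd v + int r}"
    unfolding sup_dist_def by auto
  then have "finite ?B" by (rule finite_subset) auto
  then obtain y where y: "linked (- S) v y" "y \<notin> ?B"
    using assms finite_subset[of _ ?B] by blast
  have "reaches r S v \<or> linked (?B - S) v y \<and> sup_dist v y < int r" 
    using y(1)
  proof (induction rule: linked_induct)
    case refl
    have 0: "sup_dist v v = 0" by (simp add: sup_dist_def)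
    then have "linked (?B - S) v v" using refl by (intro linked_refl) auto
    show ?case
    proof (cases "r = 0")
      case True
      then have "reaches r S v" unfolding reaches_def using 0 \<open>linked (?B - S) v v\<close> by (intro exI[of _ v]) simp
      then show ?thesis ..
    qed (use 0 \<open>linked (?B - S) v v\<close> in simp)
  next
    case (step y w)
    show ?case
    proof (cases "reaches r S v")
      case False
      then have y: "linked (?B - S) v y" "sup_dist v y < int r" using step by auto
      then have "sup_dist v w \<le> int r" using sup_dist_step[OF \<open>z2_adj y w\<close>, of v] by linarith
      then have "linked (?B - S) v w" using linked_step[OF y(1) \<open>z2_adj y w\<close>] \<open>w \<in> - S\<close> by blast
      moreover have "sup_dist v w \<noteq> int r" using False calculation unfolding reaches_def by blast
      ultimately show ?thesis using \<open>sup_dist v w \<le> int r\<close> by simp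
    qed simp
  qed
  then show ?thesis using y by auto
qed

section \<open>Chordless diagonal paths of local maxima are unlikely\<close>

definition unif :: "real measure" where
  "unif = uniform_measure lborel {0..1}"

interpretation unif: prob_space unif
  unfolding unif_def by (rule prob_space_uniform_measure) auto

lemma sets_unif [simp, measurable_cong]: "sets unif = sets borel"
  and space_unif [simp]: "space unif = UNIV"
  by (simp_all add: unif_def)

lemma age_measure_eq: "age_measure = PiM UNIV (\<lambda>_. unif)"
  by (simp add: age_measure_def unif_def)

interpretation ages: product_prob_space "\<lambda>_. unif" "UNIV :: (int \<times> int) set"
  by unfold_locales

interpretation age: prob_space age_measure
  unfolding age_measure_eq by (rule prob_space_PiM) (rule unif.prob_space_axioms)

lemma space_age_measure [simp]: "space age_measure = UNIV"
  by (simp add: age_measure_eq space_PiM)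

lemma nn_integral_unif:
  assumes "f \<in> borel_measurable borel"
  shows "(\<integral>\<^sup>+x. f x \<partial>unif) = (\<integral>\<^sup>+x. f x * indicator {0..1} x \<partial>lborel)"
  using assms unfolding unif_def by (subst nn_integral_uniform_measure) (auto simp: divide_ennreal_def)

lemma measure_unif_lessThan:
  assumes "0 \<le> t" "t \<le> 1" shows "measure unif {..<t} = t"
proof -
  have "{0..1} \<inter> {..<t} = {0..<t}" using assms by auto
  then show ?thesis using assms unfolding unif_def by (subst measure_uniform_measure) auto
qed

text \<open>On \<open>{0..1}\<close> the distribution function is the identity. The value 2/5 is the
  probability cost per point of a path.\<close>

lemma nn_integral_cdf_powr:
  "(\<integral>\<^sup>+t. ennreal (measure unif {..<t} powr (3/2)) \<partial>unif) = ennreal (2/5)"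
proof -
  have mono: "mono (\<lambda>t. measure unif {..<t})"
  proof (rule monoI)
    show "measure unif {..<x} \<le> measure unif {..<y}" if "x \<le> y" for x y
      using that by (intro unif.finite_measure_mono) auto
  qed
  have meas: "(\<lambda>t. measure unif {..<t}) \<in> borel_measurable borel"
    by (rule borel_measurable_mono[OF mono])
  have "(\<integral>\<^sup>+t. ennreal (measure unif {..<t} powr (3/2)) \<partial>unif) =
     (\<integral>\<^sup>+t. ennreal (measure unif {..<t} powr (3/2)) * indicator {0..1} t \<partial>lborel)"
    by (rule nn_integral_unif) (use meas in measurable)
  also have "\<dots> = (\<integral>\<^sup>+t. ennreal (if t \<in> {0..1} then t powr (3/2) else 0) \<partial>lborel)"
    by (rule nn_integral_cong) (auto simp: measure_unif_lessThan)
  also have "\<dots> = ennreal (2/5)"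
  proof (rule nn_integral_has_integral_lborel)
    have "((\<lambda>x. x powr (3/2)) has_integral (1 powr (3/2 + 1) / (3/2 + 1))) {0..1::real}"
      by (rule has_integral_powr_from_0) auto
    then show "((\<lambda>t. if t \<in> {0..1::real} then t powr (3/2) else 0) has_integral (2/5)) UNIV"
      by (simp only: has_integral_restrict_UNIV) simp
  qed auto
  finally show ?thesis .
qed

section \<open>Measurability of events about local maxima\<close>

lemma measurable_loc_max:
  assumes "x \<in> I" "{u. z2_adj u x} \<subseteq> I"
  shows "Measurable.pred (PiM I (\<lambda>_. unif)) (\<lambda>age. x \<in> loc_max age)"
proof -
  have c: "(\<lambda>age. age u) \<in> borel_measurable (PiM I (\<lambda>_. unif))" if "u \<in> I" for u
    using measurable_component_singleton[OF that, of "\<lambda>_. unif"] by (simp cong: measurable_cong_sets)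
  have "Measurable.pred (PiM I (\<lambda>_. unif)) (\<lambda>age. \<forall>u\<in>{u. z2_adj u x}. age u < age x)"
    using assms c by (intro pred_intros_finite borel_measurable_pred_less) auto
  then show ?thesis by (simp add: loc_max_def)
qed

text \<open>The set \<open>loc_max age \<inter> B\<close> takes finitely many values, so an
  arbitrary predicate of it is measurable. A general \<open>I\<close> serves both the full space and
  the finite blocks of the independence argument.\<close>

lemma measurable_loc_max_Int:
  assumes B: "finite B" "\<And>x. x \<in> B \<Longrightarrow> insert x {u. z2_adj u x} \<subseteq> I"
  shows "Measurable.pred (PiM I (\<lambda>_. unif)) (\<lambda>age. Q (loc_max age \<inter> B))"
proof -
  have "Q (loc_max age \<inter> B) \<longleftrightarrow> (\<exists>A\<in>{A\<in>Pow B. Q A}. \<forall>x\<in>B. x \<in> loc_max age \<longleftrightarrow> x \<in> A)" for age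
  proof
    assume "Q (loc_max age \<inter> B)"
    then show "\<exists>A\<in>{A\<in>Pow B. Q A}. \<forall>x\<in>B. x \<in> loc_max age \<longleftrightarrow> x \<in> A"
      by (intro bexI[of _ "loc_max age \<inter> B"]) auto
  next
    assume "\<exists>A\<in>{A\<in>Pow B. Q A}. \<forall>x\<in>B. x \<in> loc_max age \<longleftrightarrow> x \<in> A"
    then obtain A where A: "A \<subseteq> B" "Q A" "\<forall>x\<in>B. x \<in> loc_max age \<longleftrightarrow> x \<in> A" by blast
    then have "loc_max age \<inter> B = A" by blast
    then show "Q (loc_max age \<inter> B)" using A by simp
  qed
  moreover have "Measurable.pred (PiM I (\<lambda>_. unif)) 
    (\<lambda>age. \<exists>A\<in>{A\<in>Pow B. Q A}. \<forall>x\<in>B. x \<in> loc_max age \<longleftrightarrow> x \<in> A)"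
    using B by (intro pred_intros_finite pred_intros_logic measurable_loc_max) auto
  ultimately show ?thesis by simp
qed

lemma sets_loc_max_Int:
  assumes "finite B" shows "{age. Q (loc_max age \<inter> B)} \<in> sets age_measure"
  using measurable_loc_max_Int[of B UNIV Q] assms 
  by (simp add: pred_def age_measure_eq[symmetric])

text \<open>The left side is at most each \<open>measure unif {..<x s}\<close>, hence at most their
  geometric mean.\<close>

lemma cdf_min_le:
  assumes S: "finite S" "S \<noteq> {}"
  shows "measure unif {u. \<forall>s\<in>S. u < x s} \<le> (\<Prod>s\<in>S. measure unif {..<x s} powr (1 / card S))"
proof -
  let ?m = "measure unif {u. \<forall>s\<in>S. u < x s}"
  have "?m = ?m powr (\<Sum>s\<in>S. 1 / real (card S))" using S by simp
  also have "\<dots> = (\<Prod>s\<in>S. ?m powr (1 / real (card S)))"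
  proof (cases "?m = 0")
    case False
    then show ?thesis by (rule powr_sum)
  qed (use S in \<open>simp add: card_gt_0_iff\<close>)
  also have "\<dots> \<le> (\<Prod>s\<in>S. measure unif {..<x s} powr (1 / card S))"
    by (intro prod_mono conjI powr_mono2 unif.finite_measure_mono) auto
  finally show ?thesis .
qed

text \<open>The features of the vertex set of a chordless diagonal path that enter the probability
  bound: no adjacent points, diagonal degree at most two, and no lattice point surrounded by
  \<open>X\<close>.\<close>

definition star_sparse :: "(int \<times> int) set \<Rightarrow> bool" where
  "star_sparse X \<longleftrightarrow> (\<forall>x\<in>X. \<forall>y\<in>X. \<not> z2_adj x y) \<and>
     (\<forall>x\<in>X. \<forall>a\<in>X. \<forall>b\<in>X. \<forall>c\<in>X. diag_adj x a \<and> diag_adj x b \<and> diag_adj x c \<longrightarrow> a = b \<or> a = c \<or> b = c) \<and>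
     (\<forall>f. \<not> {u. z2_adj u f} \<subseteq> X)"

lemma star_sparse_indep: "star_sparse X \<Longrightarrow> x \<in> X \<Longrightarrow> y \<in> X \<Longrightarrow> \<not> z2_adj x y"
  unfolding star_sparse_def by simp

lemma star_sparse_degree: 
  "star_sparse X \<Longrightarrow> x \<in> X \<Longrightarrow> a \<in> X \<Longrightarrow> b \<in> X \<Longrightarrow> c \<in> X \<Longrightarrow> 
     diag_adj x a \<Longrightarrow> diag_adj x b \<Longrightarrow> diag_adj x c \<Longrightarrow> a = b \<or> a = c \<or> b = c"
  unfolding star_sparse_def by simp

lemma star_sparse_face: "star_sparse X \<Longrightarrow> \<not> {u. z2_adj u f} \<subseteq> X"
  unfolding star_sparse_def by (elim conjE) (erule allE)

text \<open>No neighbour of \<open>s\<close> sees four points of \<open>X\<close>, and at least one of them sees at most two,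
  so the weight of \<open>s\<close> is at least 3 * 1/3 + 1/2.\<close>

lemma weight_ge:
  assumes X: "star_sparse X" and s: "s \<in> X"
  shows "3/2 \<le> (\<Sum>f\<in>{f. z2_adj f s}. 1 / real (card {x\<in>X. z2_adj f x}))"
proof -
  let ?c = "\<lambda>f. card {x\<in>X. z2_adj f x}"
  let ?N = "\<lambda>f. {u. z2_adj u f}"
  have sub: "{x\<in>X. z2_adj f x} \<subseteq> ?N f" for f using z2_adj_sym by blast
  have pos: "0 < ?c f" if "f \<in> ?N s" for f
    using that s finite_subset[OF sub finite_z2_neighbours] unfolding card_gt_0_iff by blast
  have le3: "?c f \<le> 3" for f
  proof -
    obtain p where p: "p \<in> ?N f" "p \<notin> X" using star_sparse_face[OF X, of f] by blast
    then have "{x\<in>X. z2_adj f x} \<subseteq> ?N f - {p}" using sub by blast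
    then have "?c f \<le> card (?N f - {p})" by (intro card_mono) auto
    then show ?thesis using p(1) by (simp add: card_z2_neighbours)
  qed
  have two: "p \<in> X \<or> q \<in> X" if "?c f \<ge> 3" "p \<in> ?N f" "q \<in> ?N f" "p \<noteq> q" for f p q
  proof (rule ccontr)
    assume "\<not> ?thesis"
    then have "{x\<in>X. z2_adj f x} \<subseteq> ?N f - {p, q}" using sub by blast
    then have "?c f \<le> card (?N f - {p, q})" by (intro card_mono) auto
    also have "\<dots> = 2" using that by (subst card_Diff_subset) (auto simp: card_z2_neighbours)
    finally show False using that(1) by simp
  qed
  have "\<exists>f\<in>?N s. ?c f \<le> 2"
  proof (rule ccontr)
    assume "\<not> ?thesis"
    then have c3: "?c f \<ge> 3" if "f \<in> ?N s" for f
    proof -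
      have "\<not> ?c f \<le> 2" using that \<open>\<not> (\<exists>f\<in>?N s. ?c f \<le> 2)\<close> by blast
      then show ?thesis by linarith
    qed
    obtain x y where xy: "s = (x, y)" by fastforce
    have nb: "(x+1,y) \<in> ?N s" "(x-1,y) \<in> ?N s" "(x,y+1) \<in> ?N s" "(x,y-1) \<in> ?N s"
      unfolding xy by (auto simp: z2_adj_def)
    have E1: "(x+1,y+1) \<in> X \<or> (x+1,y-1) \<in> X" using two[OF c3[OF nb(1)], of "(x+1,y+1)" "(x+1,y-1)"] by (simp add: z2_adj_def)
    have E2: "(x+1,y+1) \<in> X \<or> (x+2,y) \<in> X" using two[OF c3[OF nb(1)], of "(x+1,y+1)" "(x+2,y)"] by (simp add: z2_adj_def)
    have E3: "(x+1,y-1) \<in> X \<or> (x+2,y) \<in> X" using two[OF c3[OF nb(1)], of "(x+1,y-1)" "(x+2,y)"] by (simp add: z2_adj_def)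
    have W: "(x-1,y+1) \<in> X \<or> (x-1,y-1) \<in> X" using two[OF c3[OF nb(2)], of "(x-1,y+1)" "(x-1,y-1)"] by (simp add: z2_adj_def)
    have N1: "(x+1,y+1) \<in> X \<or> (x-1,y+1) \<in> X" using two[OF c3[OF nb(3)], of "(x+1,y+1)" "(x-1,y+1)"] by (simp add: z2_adj_def)
    have N2: "(x-1,y+1) \<in> X \<or> (x,y+2) \<in> X" using two[OF c3[OF nb(3)], of "(x-1,y+1)" "(x,y+2)"] by (simp add: z2_adj_def)
    have S1: "(x+1,y-1) \<in> X \<or> (x-1,y-1) \<in> X" using two[OF c3[OF nb(4)], of "(x+1,y-1)" "(x-1,y-1)"] by (simp add: z2_adj_def)
    have S2: "(x-1,y-1) \<in> X \<or> (x,y-2) \<in> X" using two[OF c3[OF nb(4)], of "(x-1,y-1)" "(x,y-2)"] by (simp add: z2_adj_def)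
    note E = E1 E2 E3 note N = N1 N2 note S = S1 S2
    have three: "a = b \<or> a = c \<or> b = c" 
      if "z \<in> X" "a \<in> X" "b \<in> X" "c \<in> X" "diag_adj z a" "diag_adj z b" "diag_adj z c" for z a b c
      using star_sparse_degree[OF X that] .
    show False
    \<comment> \<open>By now each neighbour of \<open>s\<close> misses at most one of the points
      around it. In every case \<open>s\<close> or one of its diagonal neighbours ends up with three
      diagonal neighbours in \<open>X\<close>.\<close>
    proof (cases "(x+1,y+1) \<in> X")
      case NE: True
      show False
      proof (cases "(x-1,y-1) \<in> X")
        case SW: True
        have SE: "(x+1,y-1) \<notin> X" using three[of s "(x+1,y+1)" "(x-1,y-1)" "(x+1,y-1)"] s NE SW 
          by (auto simp: xy diag_adj_def)
        have NW: "(x-1,y+1) \<notin> X" using three[of s "(x+1,y+1)" "(x-1,y-1)" "(x-1,y+1)"] s NE SW 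
          by (auto simp: xy diag_adj_def)
        show False using three[of "(x+1,y+1)" s "(x+2,y)" "(x,y+2)"] s NE SE NW E N
          by (auto simp: xy diag_adj_def)
      next
        case SW: False
        then show False using three[of s "(x+1,y+1)" "(x-1,y+1)" "(x+1,y-1)"] s NE W S
          by (auto simp: xy diag_adj_def)
      qed
    next
      case NE: False
      then have *: "(x+1,y-1) \<in> X" "(x-1,y+1) \<in> X" "(x+2,y) \<in> X" using E N by auto
      have SW: "(x-1,y-1) \<notin> X" using three[of s "(x+1,y-1)" "(x-1,y+1)" "(x-1,y-1)"] s *
          by (auto simp: xy diag_adj_def)
      show False using three[of "(x+1,y-1)" s "(x+2,y)" "(x,y-2)"] s SW S *
          by (auto simp: xy diag_adj_def)
    qed
  qed
  then obtain g where g: "g \<in> ?N s" "?c g \<le> 2" by blast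
  have "3/2 \<le> 1 / real (?c g) + (\<Sum>f\<in>?N s - {g}. 1 / real (?c f))"
  proof -
    have inv: "1 / real m \<le> 1 / real c" if "0 < c" "c \<le> m" for c m :: nat
      using that by (simp add: frac_le)
    have "1 / real 2 \<le> 1 / real (?c g)" using g(2) pos[OF g(1)] by (intro inv)
    moreover have "(\<Sum>f\<in>?N s - {g}. 1 / real 3) \<le> (\<Sum>f\<in>?N s - {g}. 1 / real (?c f))"
      by (intro sum_mono inv le3 pos) blast
    moreover have "card (?N s - {g}) = 3" using g(1) by (simp add: card_z2_neighbours)
    then have "(\<Sum>f\<in>?N s - {g}. 1 / real 3) = 1" by simp
    ultimately show ?thesis by linarith
  qed
  also have "\<dots> = (\<Sum>f\<in>?N s. 1 / real (?c f))" using sum.remove[OF finite_z2_neighbours g(1), of "\<lambda>f. 1 / real (?c f)"] by simp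
  finally show ?thesis .
qed

lemma prob_loc_max_le:
  assumes fin: "finite X" and X: "star_sparse X"
  shows "measure age_measure {age. X \<subseteq> loc_max age} \<le> (2/5) ^ card X"
proof -
  define N where "N x = {u. z2_adj u x}" for x
  define F where "F = (\<Union>x\<in>X. N x)"
  define S where "S f = {x\<in>X. z2_adj f x}" for f
  define g where "g t = measure unif {..<t}" for t
  have finN: "finite (N x)" for x unfolding N_def by simp
  have finF: "finite F" unfolding F_def using fin finN by blast
  have disj: "X \<inter> F = {}" unfolding F_def N_def using star_sparse_indep[OF X] by blast
  have finS: "finite (S f)" for f unfolding S_def using fin by simp
  have S0: "S f \<noteq> {}" if "f \<in> F" for f using that unfolding F_def S_def N_def by blast
  have g01: "0 \<le> g t" "g t \<le> 1" for t unfolding g_def by auto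
  have gmeas: "g \<in> borel_measurable borel"
    by (rule borel_measurable_mono) (auto simp: mono_def g_def intro!: unif.finite_measure_mono)
  let ?P = "\<lambda>J. PiM J (\<lambda>_. unif)"
  let ?J = "X \<union> F"
  define E where "E = {\<omega> \<in> space (?P ?J). X \<subseteq> loc_max \<omega>}"
  have E: "E \<in> sets (?P ?J)"
  proof -
    have "Measurable.pred (?P ?J) (\<lambda>\<omega>. \<forall>x\<in>X. x \<in> loc_max \<omega>)"
      using fin by (intro pred_intros_finite measurable_loc_max) (auto simp: F_def N_def)
    then show ?thesis unfolding E_def pred_def subset_eq .
  qed
  \<comment> \<open>The event depends only on the ages on \<open>X\<close> and on its neighbours
    \<open>F\<close>, so it can be measured on a finite product.\<close>
  have "emeasure age_measure {age. X \<subseteq> loc_max age} = emeasure (?P ?J) E"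
  proof -
    have "?P ?J = distr (?P UNIV) (?P ?J) (\<lambda>\<omega>. restrict \<omega> ?J)"
      using ages.distr_PiM_restrict_finite[of ?J] fin finF by simp
    then have "emeasure (?P ?J) E = emeasure (distr (?P UNIV) (?P ?J) (\<lambda>\<omega>. restrict \<omega> ?J)) E" by simp
    also have "\<dots> = emeasure (?P UNIV) ((\<lambda>\<omega>. restrict \<omega> ?J) -` E \<inter> space (?P UNIV))"
      using E by (intro emeasure_distr measurable_restrict_subset) auto
    also have "(\<lambda>\<omega>. restrict \<omega> ?J) -` E \<inter> space (?P UNIV) = {age. X \<subseteq> loc_max age}"
    proof -
      have "x \<in> loc_max (restrict \<omega> ?J) \<longleftrightarrow> x \<in> loc_max \<omega>" if "x \<in> X" for x \<omega>
      proof -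
        have "restrict \<omega> ?J u = \<omega> u" if "z2_adj u x" for u using that \<open>x \<in> X\<close> by (auto simp: F_def N_def)
        then show ?thesis using that by (simp add: loc_max_def)
      qed
      then show ?thesis by (auto simp: E_def space_PiM)
    qed
    finally show ?thesis by (simp add: age_measure_eq)
  qed
  also have "\<dots> = (\<integral>\<^sup>+\<omega>. indicator E \<omega> \<partial>?P ?J)" using E by simp
  \<comment> \<open>Fix the ages on \<open>X\<close>. Since \<open>X\<close> and \<open>F\<close>
    are disjoint, the remaining condition bounds each \<open>y f\<close> separately and has a
    product probability.\<close>
  also have "\<dots> = (\<integral>\<^sup>+x. (\<integral>\<^sup>+y. indicator E (merge X F (x, y)) \<partial>?P F) \<partial>?P X)"
    using E by (intro ages.product_nn_integral_fold disj fin finF) simp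
  also have "\<dots> \<le> (\<integral>\<^sup>+x. (\<Prod>s\<in>X. ennreal (g (x s) powr (3/2))) \<partial>?P X)"
  proof (rule nn_integral_mono)
    fix x assume x: "x \<in> space (?P X)"
    define A where "A f = {u. \<forall>s\<in>S f. u < x s}" for f
    have A: "A f \<in> sets unif" for f
    proof -
      have "{u. \<forall>s\<in>S f. u < x s} = (\<Inter>s\<in>S f. {..<x s})" by auto
      moreover have "open (\<Inter>s\<in>S f. {..<x s})" using finS by (intro open_INT) auto
      ultimately show ?thesis unfolding A_def by simp
    qed
    have "indicator E (merge X F (x, y)) = (indicator (Pi\<^sub>E F A) y :: ennreal)" if y: "y \<in> space (?P F)" for y
    proof -
      have m: "merge X F (x, y) s = x s" if "s \<in> X" for s using that by (simp add: merge_def)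
      have mF: "merge X F (x, y) f = y f" if "f \<in> F" for f using that disj by (auto simp: merge_def)
      have "merge X F (x, y) \<in> space (?P ?J)" using x y disj by (auto simp: space_PiM merge_def PiE_def extensional_def)
      then have "merge X F (x, y) \<in> E \<longleftrightarrow> (\<forall>s\<in>X. \<forall>f\<in>N s. merge X F (x, y) f < merge X F (x, y) s)"
        by (auto simp: E_def loc_max_def N_def)
      also have "\<dots> \<longleftrightarrow> (\<forall>s\<in>X. \<forall>f\<in>N s. y f < x s)" 
      proof (intro ball_cong refl)
        fix s f assume "s \<in> X" "f \<in> N s"
        then show "merge X F (x, y) f < merge X F (x, y) s \<longleftrightarrow> y f < x s"
          using m[of s] mF[of f] UN_I[of s X f N] unfolding F_def by simp
      qed
      also have "\<dots> \<longleftrightarrow> y \<in> Pi\<^sub>E F A" using y by (auto simp: A_def S_def F_def N_def space_PiM PiE_iff)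
      finally show ?thesis by (simp add: indicator_def)
    qed
    then have "(\<integral>\<^sup>+y. indicator E (merge X F (x, y)) \<partial>?P F) = (\<integral>\<^sup>+y. indicator (Pi\<^sub>E F A) y \<partial>?P F)"
      by (rule nn_integral_cong)
    also have "\<dots> = emeasure (?P F) (Pi\<^sub>E F A)" using A finF by (intro nn_integral_indicator sets_PiM_I_finite) auto
    also have "\<dots> = (\<Prod>f\<in>F. emeasure unif (A f))" using A finF by (intro ages.emeasure_PiM) auto
    also have "\<dots> = ennreal (\<Prod>f\<in>F. measure unif (A f))"
      by (simp add: unif.emeasure_eq_measure prod_ennreal)
    also have "\<dots> \<le> ennreal (\<Prod>s\<in>X. g (x s) powr (3/2))"
    proof (rule ennreal_leI)
      have "(\<Prod>f\<in>F. measure unif (A f)) \<le> (\<Prod>f\<in>F. \<Prod>s\<in>S f. g (x s) powr (1 / card (S f)))"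
        unfolding A_def g_def using S0 finS by (intro prod_mono conjI cdf_min_le) auto
      \<comment> \<open>Exchanging the products collects at each \<open>s\<close> the exponents from
        its four neighbours. Their sum is at least 3/2 by \<open>weight_ge\<close>, and
        \<open>g\<close> is at most 1, so the power only grows when the exponent is lowered to
        3/2.\<close>
      also have "\<dots> = (\<Prod>s\<in>X. \<Prod>f\<in>{f. f \<in> F \<and> z2_adj f s}. g (x s) powr (1 / card (S f)))"
        unfolding S_def by (rule prod.swap_restrict[OF finF fin])
      also have "\<dots> \<le> (\<Prod>s\<in>X. g (x s) powr (3/2))"
      proof (rule prod_mono, intro conjI)
        fix s assume s: "s \<in> X"
        show "0 \<le> (\<Prod>f\<in>{f. f \<in> F \<and> z2_adj f s}. g (x s) powr (1 / card (S f)))"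
          by (intro prod_nonneg) auto
        have N: "{f. f \<in> F \<and> z2_adj f s} = N s" using s by (auto simp: F_def N_def)
        show "(\<Prod>f\<in>{f. f \<in> F \<and> z2_adj f s}. g (x s) powr (1 / card (S f))) \<le> g (x s) powr (3/2)"
        \<comment> \<open>The rule \<open>powr_sum\<close> excludes the base 0, for which both sides
          vanish.\<close>
        proof (cases "g (x s) = 0")
          case True
          moreover have "card (N s) = 4" unfolding N_def by (rule card_z2_neighbours)
          ultimately show ?thesis unfolding N by simp
        next
          case False
          then have "(\<Prod>f\<in>N s. g (x s) powr (1 / card (S f))) = g (x s) powr (\<Sum>f\<in>N s. 1 / card (S f))"
            by (rule powr_sum[symmetric])
          also have "\<dots> \<le> g (x s) powr (3/2)"
            using weight_ge[OF X s] g01 unfolding N_def S_def by (intro powr_mono') auto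
          finally show ?thesis unfolding N .
        qed
      qed
      finally show "(\<Prod>f\<in>F. measure unif (A f)) \<le> (\<Prod>s\<in>X. g (x s) powr (3/2))" .
    qed
    also have "\<dots> = (\<Prod>s\<in>X. ennreal (g (x s) powr (3/2)))" by (simp add: prod_ennreal)
    finally show "(\<integral>\<^sup>+y. indicator E (merge X F (x, y)) \<partial>?P F) \<le> (\<Prod>s\<in>X. ennreal (g (x s) powr (3/2)))" .
  qed
  also have "\<dots> = (\<Prod>s\<in>X. (\<integral>\<^sup>+t. ennreal (g t powr (3/2)) \<partial>unif))"
    by (rule ages.product_nn_integral_prod[OF fin]) (use gmeas in measurable)
  also have "\<dots> = ennreal ((2/5) ^ card X)"
    unfolding g_def nn_integral_cdf_powr prod_constant by (simp add: ennreal_power)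
  finally show ?thesis unfolding age.emeasure_eq_measure by (simp add: ennreal_le_iff)
qed

section \<open>Chordless paths as sparse sets\<close>

lemma chordless_path_inj:
  assumes "chordless_path k p" shows "inj_on p {..k}"
  using assms unfolding chordless_path_def inj_on_def by (metis atMost_iff linorder_neqE_nat)

lemma chordless_path_adj:
  assumes "chordless_path k p" "i \<le> k" "j \<le> k" "diag_adj (p i) (p j)"
  shows "j = Suc i \<or> i = Suc j"
proof -
  have "i \<noteq> j" using assms(4) by (auto simp: diag_adj_def)
  then consider "i < j" | "j < i" by linarith
  then show ?thesis
  proof cases
    case 1
    then show ?thesis using assms unfolding chordless_path_def by blast
  next
    case 2
    then show ?thesis using assms(1,2) diag_adj_sym[OF assms(4)] unfolding chordless_path_def by blast
  qed
qed

text \<open>Diagonal steps preserve the checkerboard colour, so lattice-adjacent points never lie on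
  one path.\<close>

lemma chordless_path_parity:
  assumes "chordless_path k p" "i \<le> k"
  shows "even (fst (p i) + snd (p i)) \<longleftrightarrow> even (fst (p 0) + snd (p 0))"
  using assms(2)
proof (induction i)
  case (Suc i)
  have "diag_adj (p i) (p (Suc i))" using assms(1) Suc.prems unfolding chordless_path_def by simp
  then have "odd (fst (p i) - fst (p (Suc i)))" "odd (snd (p i) - snd (p (Suc i)))"
    unfolding diag_adj_def by presburger+
  then have "even (fst (p (Suc i)) + snd (p (Suc i))) \<longleftrightarrow> even (fst (p i) + snd (p i))" by auto
  then show ?case using Suc by simp
qed simp

text \<open>Parity excludes adjacency, and only predecessor and successor are diagonal neighbours.
  The four neighbours of a lattice point would form a diagonal 4-cycle, which a chordless path
  cannot contain.\<close>

lemma chordless_path_sparse: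
  assumes p: "chordless_path k p" shows "star_sparse (p ` {..k})"
  unfolding star_sparse_def
proof (intro conjI ballI allI impI)
  fix x y assume "x \<in> p ` {..k}" "y \<in> p ` {..k}"
  then have "even (fst x + snd x) \<longleftrightarrow> even (fst y + snd y)" using chordless_path_parity[OF p] by auto
  then have "even ((fst x - fst y) + (snd x - snd y))" by auto
  then show "\<not> z2_adj x y" unfolding z2_adj_def by presburger
next
  fix x a b c assume "x \<in> p ` {..k}" "a \<in> p ` {..k}" "b \<in> p ` {..k}" "c \<in> p ` {..k}" 
    and d: "diag_adj x a \<and> diag_adj x b \<and> diag_adj x c"
  then obtain i ia ib ic where i: "x = p i" "a = p ia" "b = p ib" "c = p ic" "i \<le> k" "ia \<le> k" "ib \<le> k" "ic \<le> k"
    by auto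
  have "ia = Suc i \<or> i = Suc ia" "ib = Suc i \<or> i = Suc ib" "ic = Suc i \<or> i = Suc ic"
    using chordless_path_adj[OF p] d i by metis+
  then have "ia = ib \<or> ia = ic \<or> ib = ic" by auto
  then show "a = b \<or> a = c \<or> b = c" using i by auto
next
  fix f
  show "\<not> {u. z2_adj u f} \<subseteq> p ` {..k}"
  proof
    assume *: "{u. z2_adj u f} \<subseteq> p ` {..k}"
    obtain x y where f: "f = (x, y)" by fastforce
    obtain e n w s where e: "p e = (x + 1, y)" "e \<le> k" and n: "p n = (x, y + 1)" "n \<le> k" 
      and w: "p w = (x - 1, y)" "w \<le> k" and s: "p s = (x, y - 1)" "s \<le> k"
      using * unfolding f z2_neighbours by (auto simp: image_iff)
    have "n = Suc e \<or> e = Suc n" "w = Suc n \<or> n = Suc w" "s = Suc w \<or> w = Suc s" "e = Suc s \<or> s = Suc e"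
      by (rule chordless_path_adj[OF p]; use e n w s in \<open>simp add: diag_adj_def\<close>)+
    moreover have "e \<noteq> w" "n \<noteq> s" using e n w s by auto
    ultimately show False by linarith
  qed
qed

section \<open>Counting chordless paths by their steps\<close>

definition dirs :: "(int \<times> int) set" where
  "dirs = {(1, 1), (1, -1), (-1, 1), (-1, -1)}"

lemma diag_adj_iff_dirs: "diag_adj u v \<longleftrightarrow> v - u \<in> dirs"
  by (cases u; cases v) (auto simp: diag_adj_def dirs_def)

lemma card_dirs: "card dirs = 4" and finite_dirs [simp]: "finite dirs"
  by (auto simp: dirs_def)

lemma uminus_dirs: "- a \<in> dirs \<longleftrightarrow> a \<in> dirs"
  by (cases a) (auto simp: dirs_def)

lemma dirs_neq_uminus: "a \<in> dirs \<Longrightarrow> a \<noteq> - a"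
  by (auto simp: dirs_def)

text \<open>\<open>turns n a b\<close> contains the possible continuations by \<open>n\<close> steps of a chordless diagonal path whose
  last two steps are \<open>a\<close> and \<open>b\<close>: a step \<open>- b\<close> reverses the path, and a step \<open>- a\<close> creates a chord.
  A path with a single step \<open>d\<close> is treated as if \<open>d\<close> had been made twice.\<close>

primrec turns :: "nat \<Rightarrow> int \<times> int \<Rightarrow> int \<times> int \<Rightarrow> (int \<times> int) list set" where
  "turns 0 a b = {[]}"
| "turns (Suc n) a b = (\<Union>c\<in>dirs - {- a, - b}. (#) c ` turns n b c)"

lemma finite_turns [simp]: "finite (turns n a b)"
  by (induction n arbitrary: a b) auto

text \<open>The weights 1.42 and 1 approximate the Perron eigenvector of the transfer matrix,
  whose eigenvalue is 1 + sqrt 2.\<close>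

lemma card_turns_le:
  assumes "a \<in> dirs" "b \<in> dirs" "b \<noteq> - a"
  shows "real (card (turns n a b)) \<le> (if a = b then 1.42 else 1) * 2.42 ^ n"
  using assms
proof (induction n arbitrary: a b)
  case (Suc n)
  let ?C = "dirs - {- a, - b}"
  have b: "b \<in> ?C" using Suc.prems dirs_neq_uminus by auto
  have "card (turns (Suc n) a b) \<le> (\<Sum>c\<in>?C. card ((#) c ` turns n b c))"
    unfolding turns.simps by (rule card_UN_le) simp
  also have "\<dots> = (\<Sum>c\<in>?C. card (turns n b c))" by (simp add: card_image)
  finally have "real (card (turns (Suc n) a b)) \<le> (\<Sum>c\<in>?C. real (card (turns n b c)))"
    by (simp flip: of_nat_sum)
  also have "\<dots> \<le> (\<Sum>c\<in>?C. (if b = c then 1.42 else 1) * 2.42 ^ n)"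
    using Suc.prems by (intro sum_mono Suc.IH) auto
  also have "\<dots> = (\<Sum>c\<in>?C. (if b = c then 1.42 else 1)) * 2.42 ^ n" by (rule sum_distrib_right[symmetric])
  also have "(\<Sum>c\<in>?C. (if b = c then 1.42 else 1 :: real)) = 1.42 + (\<Sum>c\<in>?C - {b}. (if b = c then 1.42 else 1))"
    using b by (subst sum.remove[of _ b]) auto
  also have "(\<Sum>c\<in>?C - {b}. (if b = c then 1.42 else 1 :: real)) = (\<Sum>c\<in>?C - {b}. 1)"
    by (rule sum.cong) auto
  also have "\<dots> = real (card ?C) - 1" using b card_gt_0_iff[of ?C] by (auto simp: of_nat_diff)
  also have "card ?C = 4 - card {- a, - b}"
    using Suc.prems by (subst card_Diff_subset) (auto simp: uminus_dirs card_dirs)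
  also have "card {- a, - b} = (if a = b then 1 else 2)" by auto
  finally have "real (card (turns (Suc n) a b)) \<le> (1.42 + (real (4 - (if a = b then 1 else 2)) - 1)) * 2.42 ^ n" .
  \<comment> \<open>For \<open>a = b\<close> there are three choices, and 1.42 + 2 is at most 1.42 *
    2.42 = 3.4364; otherwise there are two, and 1.42 + 1 = 2.42.\<close>
  also have "\<dots> \<le> ((if a = b then 1.42 else 1) * 2.42) * 2.42 ^ n"
    by (rule mult_right_mono) auto
  finally show ?case by (simp add: mult.assoc)
qed auto

primrec walk :: "int \<times> int \<Rightarrow> (int \<times> int) list \<Rightarrow> (int \<times> int) set" where
  "walk x [] = {x}"
| "walk x (d # ds) = insert x (walk (x + d) ds)"

lemma finite_walk [simp]: "finite (walk x ds)"
  by (induction ds arbitrary: x) auto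

lemma walk_eq_image:
  assumes "i \<le> k"
  shows "walk (p i) (map (\<lambda>j. p (Suc j) - p j) [i..<k]) = p ` {i..k}"
  using assms
proof (induction rule: inc_induct)
  case (step i)
  then have "[i..<k] = i # [Suc i..<k]" "{i..k} = insert i {Suc i..k}" by (auto simp: upt_rec)
  then show ?case using step by simp
qed simp

definition words :: "nat \<Rightarrow> (int \<times> int) list set" where
  "words k = (\<Union>d\<in>dirs. (#) d ` turns (k - 1) d d)"

lemma finite_words [simp]: "finite (words k)" unfolding words_def by simp

lemma card_words_le:
  assumes "k \<ge> 1"
  shows "real (card (words k)) \<le> 4 * 1.42 * 2.42 ^ (k - 1)"
proof -
  have "card (words k) \<le> (\<Sum>d\<in>dirs. card ((#) d ` turns (k - 1) d d))"
    unfolding words_def by (rule card_UN_le) simp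
  also have "\<dots> = (\<Sum>d\<in>dirs. card (turns (k - 1) d d))" by (simp add: card_image)
  finally have "real (card (words k)) \<le> (\<Sum>d\<in>dirs. real (card (turns (k - 1) d d)))"
    by (simp flip: of_nat_sum)
  also have "\<dots> \<le> (\<Sum>d\<in>dirs. 1.42 * 2.42 ^ (k - 1))"
  proof (rule sum_mono)
    fix d assume "d \<in> dirs"
    then show "real (card (turns (k - 1) d d)) \<le> 1.42 * 2.42 ^ (k - 1)"
      using card_turns_le[of d d "k - 1"] dirs_neq_uminus by auto
  qed
  also have "\<dots> = 4 * 1.42 * 2.42 ^ (k - 1)" by (simp add: card_dirs)
  finally show ?thesis .
qed

lemma chordless_path_word:
  assumes p: "chordless_path k p" and k: "k \<ge> 1"
  shows "map (\<lambda>j. p (Suc j) - p j) [0..<k] \<in> words k"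
proof -
  define d where "d j = p (Suc j) - p j" for j
  have dd: "d j \<in> dirs" if "j < k" for j
    using p that unfolding chordless_path_def d_def diag_adj_iff_dirs by blast
  have ne: "p i \<noteq> p j" "diag_adj (p i) (p j) \<Longrightarrow> j = Suc i" if "i < j" "j \<le> k" for i j
    using p that unfolding chordless_path_def by blast+
  have rev: "d i \<noteq> - d (i - 1)" if "1 \<le> i" "i < k" for i
  proof
    assume "d i = - d (i - 1)"
    then have "p (Suc i) = p (i - 1)" using that by (simp add: d_def)
    then show False using ne(1)[of "i - 1" "Suc i", OF diff_less_Suc] that by simp
  qed
  \<comment> \<open>Steps \<open>i - 2\<close> and \<open>i\<close> would cancel, so
    \<open>p (i - 2)\<close> and \<open>p (Suc i)\<close> would differ by the single step
    \<open>d (i - 1)\<close>: a chord.\<close>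
  have uturn: "d i \<noteq> - d (i - 2)" if "2 \<le> i" "i < k" for i
  proof
    assume eq: "d i = - d (i - 2)"
    have i: "Suc (i - 2) = i - 1" "Suc (i - 1) = i" using that by auto
    have "p (Suc i) - p (i - 2) = d (i - 1)" 
      using eq unfolding d_def i by (simp add: algebra_simps)
    then have "diag_adj (p (i - 2)) (p (Suc i))" unfolding diag_adj_iff_dirs using dd[of "i - 1"] that by simp
    then show False using ne(2)[of "i - 2" "Suc i", OF diff_less_Suc] that by simp
  qed
  \<comment> \<open>For \<open>i = 1\<close> the truncated index \<open>i - 2\<close> is 0, so both
    previous steps are \<open>d 0\<close>; this is the doubling of the first step.\<close>
  have "map d [i..<k] \<in> turns (k - i) (d (i - 2)) (d (i - 1))" if "1 \<le> i" "i \<le> k" for i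
    using that(2,1)
  proof (induction rule: inc_induct)
    case (step i)
    have "[i..<k] = i # [Suc i..<k]" using step by (simp add: upt_rec)
    moreover have "k - i = Suc (k - Suc i)" using step by simp
    moreover have "d i \<noteq> - d (i - 2)"
      using step rev[of i] uturn[of i] by (cases "i = 1") auto
    moreover have "map d [Suc i..<k] \<in> turns (k - Suc i) (d (i - 1)) (d i)"
      using step by (simp add: numeral_2_eq_2)
    ultimately show ?case using dd[of i] rev[of i] step by auto
  qed simp
  from this[of 1] have "map d [1..<k] \<in> turns (k - 1) (d 0) (d 0)" using k by simp
  moreover have "[0..<k] = 0 # [1..<k]" using k by (simp add: upt_rec)
  ultimately show ?thesis using dd[of 0] k unfolding words_def d_def by auto
qed

text \<open>A union bound over starting points and words. Covering the path event by a measurable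
  \<open>B\<close> is all that the later estimates need.\<close>

lemma long_path_event:
  assumes k: "k \<ge> 1"
  shows "\<exists>B\<in>sets age_measure. {age. long_path k n (loc_max age)} \<subseteq> B \<and>
     measure age_measure B \<le> (2 * real n + 1)\<^sup>2 * 0.968 ^ k"
proof -
  \<comment> \<open>A word may describe a walk that is not sparse or meets itself; its event is then
    empty. Otherwise there are \<open>k + 1\<close> points, each at cost 2/5.\<close>
  define A where "A x ds = {age. walk x ds \<subseteq> loc_max age \<and> star_sparse (walk x ds) \<and> card (walk x ds) = Suc k}" for x ds
  define B where "B = (\<Union>q\<in>grid n \<times> words k. A (fst q) (snd q))"
  have A: "A x ds \<in> sets age_measure" for x ds
    using sets_loc_max_Int[of "walk x ds" "\<lambda>S. walk x ds \<subseteq> S \<and> star_sparse (walk x ds) \<and> card (walk x ds) = Suc k"]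
    by (simp add: A_def)
  have pA: "measure age_measure (A x ds) \<le> (2/5) ^ Suc k" for x ds
  proof (cases "star_sparse (walk x ds) \<and> card (walk x ds) = Suc k")
    case True
    then show ?thesis using prob_loc_max_le[of "walk x ds"] by (auto simp: A_def)
  next
    case False
    then have "A x ds = {}" by (auto simp: A_def)
    then show ?thesis by simp
  qed
  have "B \<in> sets age_measure" unfolding B_def using A by (intro sets.finite_UN) auto
  moreover have "{age. long_path k n (loc_max age)} \<subseteq> B"
  proof clarify
    fix age assume "long_path k n (loc_max age)"
    then obtain p where p: "chordless_path k p" "\<And>i. i \<le> k \<Longrightarrow> p i \<in> loc_max age" "p 0 \<in> grid n"
      unfolding long_path_def by blast
    let ?w = "map (\<lambda>j. p (Suc j) - p j) [0..<k]"
    have w: "walk (p 0) ?w = p ` {..k}" using walk_eq_image[of 0 k p] by (simp add: atLeast0AtMost)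
    have "card (p ` {..k}) = Suc k" using card_image[OF chordless_path_inj[OF p(1)]] by simp
    then have "age \<in> A (p 0) ?w" unfolding A_def w using chordless_path_sparse[OF p(1)] p(2) by auto
    then show "age \<in> B" unfolding B_def using p(3) chordless_path_word[OF p(1) k] by force
  qed
  moreover have "measure age_measure B \<le> (2 * real n + 1)\<^sup>2 * 0.968 ^ k"
  proof -
    have "measure age_measure B \<le> (\<Sum>q\<in>grid n \<times> words k. measure age_measure (A (fst q) (snd q)))"
      unfolding B_def using A by (intro age.finite_measure_subadditive_finite) auto
    also have "\<dots> \<le> (\<Sum>q\<in>grid n \<times> words k. (2/5) ^ Suc k)" using pA by (intro sum_mono)
    also have "\<dots> = real (card (grid n)) * (real (card (words k)) * (2/5) ^ Suc k)"
      by (simp add: card_cartesian_product)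
    also have "\<dots> \<le> real (card (grid n)) * ((4 * 1.42 * 2.42 ^ (k - 1)) * (2/5) ^ Suc k)"
      by (intro mult_left_mono mult_right_mono card_words_le k) auto
    \<comment> \<open>Here 0.968 = 2.42 * 2/5, and 0.9088 = 5.68 * 4/25 lies below 0.968, which
      absorbs the constant.\<close>
    also have "(4 * 1.42 * 2.42 ^ (k - 1)) * (2/5) ^ Suc k = 0.9088 * (0.968 ^ (k - 1) :: real)"
    proof -
      have "(2/5::real) ^ Suc k = (2/5)^2 * (2/5) ^ (k - 1)" using k by (simp flip: power_add)
      moreover have "(0.968::real) ^ (k - 1) = 2.42 ^ (k - 1) * (2/5) ^ (k - 1)"
        by (simp flip: power_mult_distrib)
      ultimately show ?thesis by (simp add: power2_eq_square)
    qed
    also have "0.9088 * (0.968 ^ (k - 1) :: real) \<le> 0.968 * 0.968 ^ (k - 1)" by (rule mult_right_mono) auto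
    also have "\<dots> = 0.968 ^ k" using k by (simp flip: power_Suc)
    finally have "measure age_measure B \<le> real (card (grid n)) * 0.968 ^ k" by (simp add: mult_left_mono)
    then show ?thesis by (simp add: card_grid add.commute)
  qed
  ultimately show ?thesis by blast
qed

section \<open>Concentration of the number of locally well connected vertices\<close>

definition sup_ball :: "int \<times> int \<Rightarrow> nat \<Rightarrow> (int \<times> int) set" where
  "sup_ball v r = {u. sup_dist v u \<le> int r}"

lemma finite_sup_ball [simp]: "finite (sup_ball v r)"
proof (rule finite_subset)
  show "sup_ball v r \<subseteq> {fst v - int r..fst v + int r} \<times> {snd v - int r..snd v + int r}"
    unfolding sup_ball_def sup_dist_def by auto
qed auto

lemma sup_ball_Suc: "u \<in> sup_ball v r \<Longrightarrow> insert u {w. z2_adj w u} \<subseteq> sup_ball v (Suc r)"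
  using sup_dist_step[OF z2_adj_sym, of _ u v] unfolding sup_ball_def by fastforce

lemma reaches_local: "reaches r S v \<longleftrightarrow> reaches r (S \<inter> sup_ball v r) v"
proof -
  have "{u. sup_dist v u \<le> int r} - S \<inter> sup_ball v r = {u. sup_dist v u \<le> int r} - S"
    unfolding sup_ball_def by blast
  then show ?thesis unfolding reaches_def by simp
qed

lemma sets_reaches: "{age. reaches r (loc_max age) v} \<in> sets age_measure"
  by (subst reaches_local) (rule sets_loc_max_Int, simp)

lemma loc_max_restrict:
  assumes "sup_ball v (Suc r) \<subseteq> K"
  shows "loc_max (restrict age K) \<inter> sup_ball v r = loc_max age \<inter> sup_ball v r"
proof -
  have "x \<in> loc_max (restrict age K) \<longleftrightarrow> x \<in> loc_max age" if "x \<in> sup_ball v r" for x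
  proof -
    have "restrict age K u = age u" if "u = x \<or> z2_adj u x" for u
      using that sup_ball_Suc[OF \<open>x \<in> sup_ball v r\<close>] assms by auto
    then show ?thesis unfolding loc_max_def by auto
  qed
  then show ?thesis by blast
qed

lemma indep_vars_ages: "age.indep_vars (\<lambda>_. unif) (\<lambda>v age. age v) UNIV"
proof -
  have rv: "(\<lambda>age. age v) \<in> measurable age_measure unif" for v
    unfolding age_measure_eq by simp
  have "distr age_measure unif (\<lambda>age. age v) = unif" for v
    unfolding age_measure_eq by (rule distr_PiM_component) (auto intro: unif.prob_space_axioms)
  then show ?thesis
    by (subst age.indep_vars_iff_distr_eq_PiM)
      (auto simp: rv restrict_UNIV distr_id2 age_measure_eq[symmetric])
qed

text \<open>Local maximality looks one step beyond the path, hence the radius \<open>Suc r\<close>.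
  Functions of disjoint blocks of independent ages are independent.\<close>

lemma indep_vars_reaches:
  assumes "disjoint_family_on (\<lambda>v. sup_ball v (Suc r)) I"
  shows "age.indep_vars (\<lambda>_. borel) (\<lambda>v age. of_bool (reaches r (loc_max age) v) :: real) I"
proof -
  let ?K = "\<lambda>v. sup_ball v (Suc r)"
  have "age.indep_vars (\<lambda>v. PiM (?K v) (\<lambda>_. unif)) (\<lambda>v age. restrict (\<lambda>i. age i) (?K v)) I"
    by (rule age.indep_vars_restrict[OF indep_vars_ages _ assms]) simp
  then have "age.indep_vars (\<lambda>_. borel) 
      (\<lambda>v age. of_bool (reaches r (loc_max (restrict (\<lambda>i. age i) (?K v))) v) :: real) I"
  proof (rule age.indep_vars_compose2)
    fix v assume "v \<in> I"
    have "Measurable.pred (PiM (?K v) (\<lambda>_. unif)) (\<lambda>age. reaches r (loc_max age \<inter> sup_ball v r) v)"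
      using sup_ball_Suc by (intro measurable_loc_max_Int) auto
    then have [measurable]: "Measurable.pred (PiM (?K v) (\<lambda>_. unif)) (\<lambda>age. reaches r (loc_max age) v)"
      by (subst reaches_local)
    show "(\<lambda>age. of_bool (reaches r (loc_max age) v) :: real) \<in> borel_measurable (PiM (?K v) (\<lambda>_. unif))"
      by measurable
  qed
  moreover have "reaches r (loc_max (restrict age (?K v))) v \<longleftrightarrow> reaches r (loc_max age) v" for v age
    using reaches_local[of r "loc_max (restrict age (?K v))" v] reaches_local[of r "loc_max age" v]
      loc_max_restrict[of v r "?K v" age] by simp
  ultimately show ?thesis by simp
qed

section \<open>Translation invariance and deviation bounds\<close>

lemma linked_translate:
  assumes "linked W u v" shows "linked ((\<lambda>x. x + t) ` W) (u + t) (v + t)"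
  using assms
proof (induction rule: linked_induct)
  case (step v w)
  then have "z2_adj (v + t) (w + t)" by (simp add: z2_adj_def)
  then show ?case using step by (blast intro: linked_step)
qed (simp add: linked_refl)

lemma sup_dist_translate: "sup_dist (u + t) (v + t) = sup_dist u v"
  by (simp add: sup_dist_def)

lemma reaches_translate:
  assumes "reaches r S v" shows "reaches r ((\<lambda>x. x + t) ` S) (v + t)"
proof -
  obtain z where z: "linked ({u. sup_dist v u \<le> int r} - S) v z" "sup_dist v z = int r"
    using assms unfolding reaches_def by blast
  have "(\<lambda>x. x + t) ` ({u. sup_dist v u \<le> int r} - S) \<subseteq> {u. sup_dist (v + t) u \<le> int r} - (\<lambda>x. x + t) ` S"
    by (auto simp: sup_dist_translate)
  then have "linked ({u. sup_dist (v + t) u \<le> int r} - (\<lambda>x. x + t) ` S) (v + t) (z + t)"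
    using linked_mono[OF linked_translate[OF z(1)]] by blast
  then show ?thesis using z(2) sup_dist_translate unfolding reaches_def by metis
qed

lemma loc_max_translate: "loc_max (\<lambda>x. age (x + t)) = (\<lambda>x. x - t) ` loc_max age"
proof -
  have adj: "z2_adj (u - t) x \<longleftrightarrow> z2_adj u (x + t)" for u x by (simp add: z2_adj_def algebra_simps)
  have "x \<in> loc_max (\<lambda>x. age (x + t)) \<longleftrightarrow> x + t \<in> loc_max age" for x
  proof
    assume *: "x \<in> loc_max (\<lambda>x. age (x + t))"
    show "x + t \<in> loc_max age" unfolding loc_max_def
    proof (intro CollectI allI impI)
      fix u assume "z2_adj u (x + t)"
      then have "z2_adj (u - t) x" by (simp only: adj)
      then have "age (u - t + t) < age (x + t)" using * unfolding loc_max_def by blast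
      then show "age u < age (x + t)" by simp
    qed
  next
    assume *: "x + t \<in> loc_max age"
    show "x \<in> loc_max (\<lambda>x. age (x + t))" unfolding loc_max_def
    proof (intro CollectI allI impI)
      fix u assume "z2_adj u x"
      then have "z2_adj (u + t) (x + t)" by (simp add: z2_adj_def)
      then show "age (u + t) < age (x + t)" using * unfolding loc_max_def by blast
    qed
  qed
  then show ?thesis by (force simp: image_iff algebra_simps)
qed

text \<open>Reindexing by a shift preserves the i.i.d. product measure and carries the event at the
  origin to the event at \<open>v\<close>.\<close>

lemma prob_reaches_translate:
  "measure age_measure {age. reaches r (loc_max age) v} = measure age_measure {age. reaches r (loc_max age) (0, 0)}"
proof -
  let ?T = "\<lambda>age x. age (x + v)"
  have "distr age_measure age_measure (\<lambda>age. \<lambda>x\<in>UNIV. age (x + v)) = age_measure"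
    using distr_PiM_reindex[of UNIV "\<lambda>_. unif" "\<lambda>x. x + v" UNIV] unif.prob_space_axioms
    by (simp add: age_measure_eq)
  then have d: "distr age_measure age_measure ?T = age_measure" by (simp add: restrict_UNIV)
  have T: "?T \<in> measurable age_measure age_measure"
    unfolding age_measure_eq by (rule measurable_PiM_single') (auto simp: space_PiM)
  have "measure age_measure {age. reaches r (loc_max age) (0, 0)} = 
     measure (distr age_measure age_measure ?T) {age. reaches r (loc_max age) (0, 0)}" by (simp only: d)
  also have "\<dots> = measure age_measure (?T -` {age. reaches r (loc_max age) (0, 0)} \<inter> space age_measure)"
    by (rule measure_distr[OF T sets_reaches])
  also have "?T -` {age. reaches r (loc_max age) (0, 0)} \<inter> space age_measure = {age. reaches r (loc_max age) v}"
  proof -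
    have "reaches r (loc_max (?T age)) (0, 0) \<longleftrightarrow> reaches r (loc_max age) v" for age
      using reaches_translate[of r "loc_max (?T age)" "(0, 0)" v] reaches_translate[of r "loc_max age" v "- v"]
      by (auto simp: loc_max_translate image_image zero_prod_def[symmetric])
    then show ?thesis by auto
  qed
  finally show ?thesis ..
qed

text \<open>The event that defines \<open>Theta\<close> need not be shown measurable: monotonicity only uses the
  measurability of the larger event, and the measure of a non-measurable set is 0.\<close>

lemma Theta_le_prob_reaches: "Theta \<le> measure age_measure {age. reaches r (loc_max age) v}"
proof -
  have "Theta \<le> measure age_measure {age. reaches r (loc_max age) (0, 0)}"
    unfolding Theta_def
  proof (rule age.finite_measure_mono[OF _ sets_reaches], clarify)
    fix age K assume K: "K \<in> graph_components (first_layers z2_graph age 4)" "(0, 0) \<in> K" "infinite K"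
    then obtain x where x: "K = {y. linked (- loc_max age) x y}"
      unfolding graph_components_z2 linked_classes_def by blast
    then have "linked (- loc_max age) x (0, 0)" using K by simp
    then have "K \<subseteq> {y. linked (- loc_max age) (0, 0) y}" unfolding x using linked_sym linked_trans by blast
    then have "infinite {y. linked (- loc_max age) (0, 0) y}" using K(3) finite_subset by blast
    then show "reaches r (loc_max age) (0, 0)" by (rule linked_infinite_reaches)
  qed
  then show ?thesis using prob_reaches_translate[of r v] by simp
qed

text \<open>Hoeffding's inequality for independent indicators: each has mean at least
  \<open>Theta\<close>, so an average of \<open>Theta - t\<close> is a deviation of at least
  \<open>t\<close> per vertex.\<close>

lemma prob_few_reaches:
  assumes fin: "finite I" "I \<noteq> {}" and disj: "disjoint_family_on (\<lambda>v. sup_ball v (Suc r)) I" 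
    and t: "0 \<le> t"
  shows "measure age_measure {age. (\<Sum>v\<in>I. of_bool (reaches r (loc_max age) v)) \<le> real (card I) * (Theta - t)}
    \<le> exp (- 2 * t\<^sup>2 * card I)"
proof -
  let ?X = "\<lambda>v age. of_bool (reaches r (loc_max age) v) :: real"
  let ?\<mu> = "\<Sum>v\<in>I. age.expectation (?X v)"
  interpret H: Hoeffding_ineq age_measure I ?X "\<lambda>_. 0" "\<lambda>_. 1" ?\<mu>
    by unfold_locales (use fin indep_vars_reaches[OF disj] in auto)
  have "Theta \<le> age.expectation (?X v)" for v
  proof -
    have "age.expectation (?X v) = age.expectation (indicator {age. reaches r (loc_max age) v})"
      by (rule arg_cong[where f = age.expectation]) (auto simp: indicator_def)
    also have "\<dots> = measure age_measure {age. reaches r (loc_max age) v}" by simp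
    finally show ?thesis using Theta_le_prob_reaches by simp
  qed
  then have "(\<Sum>v\<in>I. Theta) \<le> ?\<mu>" by (intro sum_mono)
  then have \<mu>: "real (card I) * Theta \<le> ?\<mu>" by simp
  have c: "card I > 0" using fin by (simp add: card_gt_0_iff)
  have meas: "{age. (\<Sum>v\<in>I. ?X v age) \<le> ?\<mu> - real (card I) * t} \<in> age.events"
  proof -
    have [measurable]: "?X v \<in> borel_measurable age_measure" if "v \<in> I" for v
      using H.random_variable[OF that] .
    have "{age \<in> space age_measure. (\<Sum>v\<in>I. ?X v age) \<le> ?\<mu> - real (card I) * t} \<in> age.events"
      by measurable
    then show ?thesis by simp
  qed
  have "measure age_measure {age. (\<Sum>v\<in>I. ?X v age) \<le> real (card I) * (Theta - t)}
    \<le> measure age_measure {age. (\<Sum>v\<in>I. ?X v age) \<le> ?\<mu> - real (card I) * t}"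
    using meas \<mu> by (intro age.finite_measure_mono) (auto simp: algebra_simps)
  also have "\<dots> \<le> exp (- 2 * (real (card I) * t)\<^sup>2 / (\<Sum>v\<in>I. (1 - 0)\<^sup>2))"
    using H.Hoeffding_ineq_le[of "real (card I) * t"] t c by simp
  also have "- 2 * (real (card I) * t)\<^sup>2 / (\<Sum>v\<in>I. (1 - 0)\<^sup>2) = - 2 * t\<^sup>2 * card I"
    using c by (simp add: power2_eq_square field_simps)
  finally show ?thesis .
qed

text \<open>A square of side \<open>m * q\<close> splits into \<open>m\<^sup>2\<close> residue
  classes, each a \<open>q\<close> by \<open>q\<close> array of spacing \<open>m\<close>; the bounds
  for the classes are added up.\<close>

lemma card_reaches_lower:
  assumes \<theta>: "\<And>i j. i < m \<Longrightarrow> j < m \<Longrightarrow> 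
      real (q\<^sup>2) * c \<le> (\<Sum>v\<in>(\<lambda>(a, b). (s + int i + int m * a, s + int j + int m * b)) ` ({0..<int q} \<times> {0..<int q}). 
         of_bool (R v))"
  shows "real ((m * q)\<^sup>2) * c \<le> real (card {v \<in> {s..<s + int (m * q)} \<times> {s..<s + int (m * q)}. R v})"
proof -
  define \<phi> where "\<phi> p = (case p of ((i, j), a, b) \<Rightarrow> (s + int i + int m * a, s + int j + int m * b))" 
    for p :: "(nat \<times> nat) \<times> int \<times> int"
  define C where "C = {0..<int q} \<times> {0..<int q}"
  define D where "D = {..<m} \<times> {..<m}"
  have row: "i = i' \<and> a = a'" if "int i + int m * a = int i' + int m * a'" "i < m" "i' < m" for i i' a a'
  proof -
    have "i = i'" using arg_cong[OF that(1), of "\<lambda>x. x mod int m"] that(2,3) by simp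
    then show ?thesis using that by auto
  qed
  have inj: "inj_on \<phi> (D \<times> C)"
    unfolding inj_on_def D_def by (auto simp: \<phi>_def dest: row)
  have fin: "finite C" "finite D" by (auto simp: C_def D_def)
  have bound: "s + int i + int m * a \<in> {s..<s + int (m * q)}" if "i < m" "a \<in> {0..<int q}" for i a
  proof -
    have "int i + int m * a < int m * (a + 1)" using that by (simp add: algebra_simps)
    also have "\<dots> \<le> int m * int q" using that by (intro mult_left_mono) auto
    finally show ?thesis using that by simp
  qed
  have "\<phi> ` {p \<in> D \<times> C. R (\<phi> p)} \<subseteq> {v \<in> {s..<s + int (m * q)} \<times> {s..<s + int (m * q)}. R v}"
    unfolding D_def C_def using bound by (auto simp: \<phi>_def)
  then have "card (\<phi> ` {p \<in> D \<times> C. R (\<phi> p)}) \<le> card {v \<in> {s..<s + int (m * q)} \<times> {s..<s + int (m * q)}. R v}"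
    by (rule card_mono[rotated]) simp
  also have "card (\<phi> ` {p \<in> D \<times> C. R (\<phi> p)}) = card {p \<in> D \<times> C. R (\<phi> p)}"
    by (rule card_image) (rule inj_on_subset[OF inj], blast)
  finally have "real (card {p \<in> D \<times> C. R (\<phi> p)}) \<le> real (card {v \<in> {s..<s + int (m * q)} \<times> {s..<s + int (m * q)}. R v})"
    by simp
  moreover have "real (card {p \<in> D \<times> C. R (\<phi> p)}) = (\<Sum>p\<in>D \<times> C. of_bool (R (\<phi> p)))"
    using fin by (simp add: of_bool_def sum.If_cases Collect_conj_eq)
  moreover have "\<dots> = (\<Sum>ij\<in>D. \<Sum>ab\<in>C. of_bool (R (\<phi> (ij, ab))))"
    by (simp add: sum.cartesian_product)
  moreover have "\<dots> \<ge> (\<Sum>ij\<in>D. real (q\<^sup>2) * c)"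
  proof (rule sum_mono)
    fix ij assume "ij \<in> D"
    then obtain i j where ij: "ij = (i, j)" "i < m" "j < m" by (auto simp: D_def)
    let ?f = "\<lambda>(a, b). (s + int i + int m * a, s + int j + int m * b)"
    have "inj_on (\<lambda>ab. \<phi> (ij, ab)) C"
      using inj \<open>ij \<in> D\<close> by (auto simp: inj_on_def)
    moreover have f: "?f ab = \<phi> (ij, ab)" for ab by (auto simp: ij \<phi>_def split: prod.split)
    ultimately have "(\<Sum>v\<in>?f ` C. of_bool (R v)) = (\<Sum>ab\<in>C. of_bool (R (\<phi> (ij, ab))) :: real)"
      unfolding f by (subst sum.reindex) auto
    then show "real (q\<^sup>2) * c \<le> (\<Sum>ab\<in>C. of_bool (R (\<phi> (ij, ab))))"
      using \<theta>[OF ij(2,3)] unfolding C_def by simp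
  qed
  moreover have "(\<Sum>ij\<in>D. real (q\<^sup>2) * c) = real ((m * q)\<^sup>2) * c"
    by (simp add: D_def card_cartesian_product power2_eq_square)
  ultimately show ?thesis by linarith
qed

text \<open>Distinct points of a class differ by at least \<open>m\<close> in some coordinate, one
  more than twice the radius \<open>r + 1\<close>.\<close>

lemma disjoint_residue_class_balls:
  assumes "m = 2 * r + 3"
  shows "disjoint_family_on (\<lambda>v. sup_ball v (Suc r))
    ((\<lambda>(a, b). (s + int m * a, t + int m * b)) ` (A \<times> B))"
proof -
  have "a = c \<and> b = d" 
    if u: "u \<in> sup_ball (s + int m * a, t + int m * b) (Suc r)" "u \<in> sup_ball (s + int m * c, t + int m * d) (Suc r)"
    for u a b c d
  proof -
    have *: "x = y" if "\<bar>(z + int m * x) - w\<bar> \<le> int (Suc r)" "\<bar>(z + int m * y) - w\<bar> \<le> int (Suc r)" for x y z w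
    proof -
      have "\<bar>X - Y\<bar> \<le> 2 * k" if "\<bar>(z + X) - w\<bar> \<le> k" "\<bar>(z + Y) - w\<bar> \<le> k" for X Y k :: int
        using that by linarith
      from this[OF that] have "\<bar>int m * x - int m * y\<bar> \<le> 2 * int (Suc r)" .
      moreover have "\<bar>int m * x - int m * y\<bar> = int m * \<bar>x - y\<bar>"
        by (simp add: abs_mult flip: right_diff_distrib)
      moreover have "2 * int (Suc r) < int m * 1" using assms by simp
      ultimately have "int m * \<bar>x - y\<bar> < int m * 1" by (simp only:)
      then have "\<bar>x - y\<bar> < 1" by (rule mult_left_less_imp_less) simp
      then show ?thesis by simp
    qed
    show ?thesis using u *[of s a "fst u" c] *[of t b "snd u" d] by (auto simp: sup_ball_def sup_dist_def)
  qed
  then show ?thesis unfolding disjoint_family_on_def by fast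
qed

text \<open>The exceptional events are a long path of local maxima and a residue class with too few
  vertices that reach distance \<open>r\<close>. Outside them, those vertices in the square of side
  \<open>m * q\<close> give a lower bound for \<open>card GC\<close>.\<close>

lemma prob_small_largest_component:
  fixes \<epsilon> :: real
  assumes r: "1 \<le> r" "r < n" and m: "m = 2 * r + 3" and q: "1 \<le> q" "m * q \<le> 2 * (n - r) + 1"
    and \<epsilon>: "0 < \<epsilon>" and Th: "0 < Theta" and count: "4 * (real n)\<^sup>2 * (1 - \<epsilon>) \<le> real ((m * q)\<^sup>2) * (1 - \<epsilon> / 2)"
  shows "measure age_measure {age. \<exists>GC. largest_component (first_layers (box_graph n) age 4) GC \<and>
                     real (card GC) < 4 * real n ^ 2 * (1 - \<epsilon>) * Theta}
     \<le> (2 * real n + 1)\<^sup>2 * 0.968 ^ r + real (m\<^sup>2) * exp (- (\<epsilon>\<^sup>2 * Theta\<^sup>2 / 2) * real (q\<^sup>2))"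
proof -
  \<comment> \<open>The lower left corner of the square of vertices whose \<open>r\<close>-balls lie
    in the box. That square has side \<open>2 * (n - r) + 1\<close>, so \<open>m * q\<close>
    fits.\<close>
  define s where "s = int r - int n"
  define I where "I i j = (\<lambda>(a, b). (s + int i + int m * a, s + int j + int m * b)) ` ({0..<int q} \<times> {0..<int q})" for i j
  \<comment> \<open>Half of \<epsilon> pays for the deviation; the other half, through
    \<open>count\<close>, for the vertices outside the square of side \<open>m * q\<close>.\<close>
  define t where "t = \<epsilon> / 2 * Theta"
  define H where "H i j = {age. (\<Sum>v\<in>I i j. of_bool (reaches r (loc_max age) v)) \<le> real (card (I i j)) * (Theta - t)}" for i j
  have cI: "card (I i j) = q\<^sup>2" for i j
    unfolding I_def using m by (subst card_image) (auto simp: inj_on_def card_cartesian_product power2_eq_square)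
  have finI: "finite (I i j)" for i j by (simp add: I_def)
  have pH: "measure age_measure (H i j) \<le> exp (- (\<epsilon>\<^sup>2 * Theta\<^sup>2 / 2) * real (q\<^sup>2))" for i j
  proof -
    have "disjoint_family_on (\<lambda>v. sup_ball v (Suc r)) (I i j)"
      unfolding I_def by (rule disjoint_residue_class_balls[OF m])
    moreover have "I i j \<noteq> {}" using q(1) by (auto simp: I_def)
    ultimately have "measure age_measure (H i j) \<le> exp (- 2 * t\<^sup>2 * real (card (I i j)))"
      unfolding H_def using Th \<epsilon> by (intro prob_few_reaches finI) (auto simp: t_def)
    also have "- 2 * t\<^sup>2 * real (card (I i j)) = - (\<epsilon>\<^sup>2 * Theta\<^sup>2 / 2) * real (q\<^sup>2)"
      by (simp add: cI t_def power2_eq_square)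
    finally show ?thesis .
  qed
  have H: "H i j \<in> sets age_measure" for i j
  proof -
    have [measurable]: "Measurable.pred age_measure (\<lambda>age. reaches r (loc_max age) v)" for v
      using sets_reaches[of r v] by (simp add: pred_def)
    have "{age \<in> space age_measure. (\<Sum>v\<in>I i j. of_bool (reaches r (loc_max age) v)) \<le> real (card (I i j)) * (Theta - t)} \<in> sets age_measure"
      by measurable
    then show ?thesis by (simp add: H_def)
  qed
  obtain B where B: "B \<in> sets age_measure" "{age. long_path r n (loc_max age)} \<subseteq> B"
     "measure age_measure B \<le> (2 * real n + 1)\<^sup>2 * 0.968 ^ r"
    using long_path_event[OF r(1), of n] by blast
  define HH where "HH = (\<Union>ij\<in>{..<m} \<times> {..<m}. H (fst ij) (snd ij))"
  have HH: "HH \<in> sets age_measure" unfolding HH_def using H by (intro sets.finite_UN) auto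
  have pHH: "measure age_measure HH \<le> real (m\<^sup>2) * exp (- (\<epsilon>\<^sup>2 * Theta\<^sup>2 / 2) * real (q\<^sup>2))"
  proof -
    have "measure age_measure HH \<le> (\<Sum>ij\<in>{..<m} \<times> {..<m}. measure age_measure (H (fst ij) (snd ij)))"
      unfolding HH_def using H by (intro age.finite_measure_subadditive_finite) auto
    also have "\<dots> \<le> (\<Sum>ij\<in>{..<m} \<times> {..<m}. exp (- (\<epsilon>\<^sup>2 * Theta\<^sup>2 / 2) * real (q\<^sup>2)))"
      using pH by (intro sum_mono)
    finally show ?thesis by (simp add: card_cartesian_product power2_eq_square)
  qed
  have "{age. \<exists>GC. largest_component (first_layers (box_graph n) age 4) GC \<and>
                     real (card GC) < 4 * real n ^ 2 * (1 - \<epsilon>) * Theta} \<subseteq> B \<union> HH"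
  proof clarify
    fix age GC assume GC: "largest_component (first_layers (box_graph n) age 4) GC"
      and small: "real (card GC) < 4 * real n ^ 2 * (1 - \<epsilon>) * Theta" and nHH: "age \<notin> HH"
    show "age \<in> B"
    proof (rule ccontr)
      assume "age \<notin> B"
      then have np: "\<not> long_path r n (loc_max age)" using B(2) by blast
      let ?S = "{s..<s + int (m * q)} \<times> {s..<s + int (m * q)}"
      have "real (q\<^sup>2) * (Theta - t) \<le> (\<Sum>v\<in>I i j. of_bool (reaches r (loc_max age) v))" if "i < m" "j < m" for i j
      proof -
        have "age \<notin> H i j" using nHH that unfolding HH_def by force
        then show ?thesis unfolding H_def cI by simp
      qed
      then have "real ((m * q)\<^sup>2) * (Theta - t) \<le> real (card {v \<in> ?S. reaches r (loc_max age) v})"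
        unfolding I_def by (rule card_reaches_lower)
      also have "card {v \<in> ?S. reaches r (loc_max age) v} \<le> card GC"
      proof (rule largest_component_ge[OF _ np GC])
        show "1 \<le> n" using r by simp
        fix v assume v: "v \<in> ?S"
        have "int (m * q) \<le> int (2 * (n - r) + 1)" using q(2) by (simp only: of_nat_le_iff)
        also have "\<dots> = 2 * (int n - int r) + 1" using r(2) by (simp add: of_nat_diff)
        finally have "int (m * q) \<le> 2 * (int n - int r) + 1" .
        then have "\<bar>fst v\<bar> \<le> int n - int r" "\<bar>snd v\<bar> \<le> int n - int r" using v unfolding s_def by auto
        then show "{u. sup_dist v u \<le> int r} \<subseteq> grid n" unfolding sup_dist_def grid_def by auto
      qed
      finally have "real ((m * q)\<^sup>2) * (Theta - t) \<le> real (card GC)" by simp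
      moreover have "4 * (real n)\<^sup>2 * (1 - \<epsilon>) * Theta \<le> real ((m * q)\<^sup>2) * (1 - \<epsilon> / 2) * Theta"
        using count Th by (intro mult_right_mono) auto
      moreover have "(1 - \<epsilon> / 2) * Theta = Theta - t" by (simp add: t_def algebra_simps)
      ultimately show False using small by (simp add: mult.assoc)
    qed
  qed
  then have "measure age_measure {age. \<exists>GC. largest_component (first_layers (box_graph n) age 4) GC \<and>
                     real (card GC) < 4 * real n ^ 2 * (1 - \<epsilon>) * Theta} \<le> measure age_measure (B \<union> HH)"
    using B(1) HH by (intro age.finite_measure_mono) auto
  also have "\<dots> \<le> measure age_measure B + measure age_measure HH"
    using B(1) HH by (rule measure_Un_le)
  finally show ?thesis using B(3) pHH by linarith
qed

section \<open>Asymptotics\<close>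

text \<open>Here \<open>q\<close> has order \<open>n powr (4/5)\<close>, so the Hoeffding term beats
  \<open>exp (- (n powr (1/5)))\<close> whatever \<epsilon> and \<open>Theta\<close> are; they only
  influence how large \<open>n\<close> must be. Hence the absolute constant 1.\<close>

lemma largest_component_lower_tail:
  fixes c :: real
  defines "c \<equiv> - ln 0.968"
  assumes \<epsilon>: "\<epsilon> \<in> {0<..<1::real}"
  shows "\<forall>\<^sub>F n in sequentially.
     measure age_measure {age \<in> space age_measure.
       \<exists>GC. largest_component (first_layers (box_graph n) age 4) GC \<and>
            real (card GC) < 4 * real n ^ 2 * (1 - \<epsilon>) * Theta}
     \<le> exp (- 1 * \<epsilon> ^ 2 * real n powr (1 / 5)) + 4 * real n ^ 2 * exp (- (c / 2) * real n powr (1 / 5))"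
    (is "\<forall>\<^sub>F n in sequentially. measure age_measure (?E n) \<le> ?R n")
proof (cases "Theta > 0")
  \<comment> \<open>The threshold for \<open>card GC\<close> is then at most 0 and the event is
    empty.\<close>
  case False
  have "?E n = {}" for n
  proof -
    have "4 * real n ^ 2 * (1 - \<epsilon>) * Theta \<le> 0"
      using False \<epsilon> by (intro mult_nonneg_nonpos) auto
    then have "\<not> real (card GC) < 4 * real n ^ 2 * (1 - \<epsilon>) * Theta" for GC :: "(int \<times> int) set"
      using of_nat_0_le_iff[of "card GC", where 'a = real] by linarith
    then show ?thesis by blast
  qed
  then show ?thesis by (intro always_eventually allI) (simp only: measure_empty, simp)
next
  case Th: True
  define \<delta> where "\<delta> = \<epsilon>\<^sup>2 * Theta\<^sup>2 / 2"
  have \<delta>: "\<delta> > 0" using Th \<epsilon> by (simp add: \<delta>_def)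
  have c: "c > 0" unfolding c_def by simp
  have ce: "0.968 = exp (- c)" unfolding c_def by simp
  have e1: "\<forall>\<^sub>F n in sequentially. 4 * real n powr (1/5) + 2 \<le> 2 * real n" by real_asymp
  have e2: "\<forall>\<^sub>F n in sequentially. 1 \<le> real n powr (1/5)" by real_asymp
  have e3: "\<forall>\<^sub>F n in sequentially. 4 * (1 - \<epsilon>) / (1 - \<epsilon> / 2) < (2 * real n - 4 * real n powr (1/5) - 1)\<^sup>2 / (real n)\<^sup>2"
  proof (rule order_tendstoD)
    show "(\<lambda>n. (2 * real n - 4 * real n powr (1/5) - 1)\<^sup>2 / (real n)\<^sup>2) \<longlonglongrightarrow> 4" by real_asymp
    show "4 * (1 - \<epsilon>) / (1 - \<epsilon> / 2) < 4" using \<epsilon> by (simp add: divide_simps)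
  qed
  have e4: "\<forall>\<^sub>F n in sequentially. 9 * exp c * exp (- (c / 2) * real n powr (1/5)) \<le> 4"
    using c by real_asymp
  have e5: "\<forall>\<^sub>F n in sequentially. (2 * real n powr (1/5) + 3)\<^sup>2 *
      exp (- \<delta> * ((2 * real n - 4 * real n powr (1/5) - 1) / (2 * real n powr (1/5) + 3))\<^sup>2) 
      \<le> exp (- (real n powr (1/5)))"
    using \<delta> by real_asymp
  show ?thesis
    using e1 e2 e3 e4 e5
  proof eventually_elim
    fix n :: nat
    define x where "x = real n powr (1/5)"
    assume "4 * real n powr (1/5) + 2 \<le> 2 * real n" "1 \<le> real n powr (1/5)"
      "4 * (1 - \<epsilon>) / (1 - \<epsilon> / 2) < (2 * real n - 4 * real n powr (1/5) - 1)\<^sup>2 / (real n)\<^sup>2"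
      "9 * exp c * exp (- (c / 2) * real n powr (1/5)) \<le> 4"
      "(2 * real n powr (1/5) + 3)\<^sup>2 *
        exp (- \<delta> * ((2 * real n - 4 * real n powr (1/5) - 1) / (2 * real n powr (1/5) + 3))\<^sup>2) \<le> exp (- (real n powr (1/5)))"
    then have a1: "4 * x + 2 \<le> 2 * real n" and a2: "1 \<le> x"
      and a3: "4 * (1 - \<epsilon>) / (1 - \<epsilon> / 2) < (2 * real n - 4 * x - 1)\<^sup>2 / (real n)\<^sup>2"
      and a4: "9 * exp c * exp (- (c / 2) * x) \<le> 4"
      and a5: "(2 * x + 3)\<^sup>2 * exp (- \<delta> * ((2 * real n - 4 * x - 1) / (2 * x + 3))\<^sup>2) \<le> exp (- x)"
      unfolding x_def by this+
    define r where "r = nat \<lfloor>x\<rfloor>"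
    define m where "m = 2 * r + 3"
    define q where "q = (2 * (n - r) + 1) div m"
    have rx: "real r \<le> x" "x - 1 < real r" "1 \<le> r" using a2 unfolding r_def by (auto simp: le_nat_iff)
    have n1: "1 \<le> real n" using a1 a2 by linarith
    have "real r < real n" using rx a1 a2 by linarith
    then have rn: "r < n" by simp
    have nr: "real (n - r) = real n - real r" using rn by (simp add: of_nat_diff)
    have "real m \<le> real (2 * (n - r) + 1)" using rx a1 by (simp add: m_def nr)
    then have "m \<le> 2 * (n - r) + 1" by (simp only: of_nat_le_iff)
    then have q1: "1 \<le> q" unfolding q_def by (simp add: m_def div_greater_zero_iff Suc_le_eq)
    have mq: "m * q \<le> 2 * (n - r) + 1" unfolding q_def by simp
    \<comment> \<open>Rounding down in \<open>q\<close> loses at most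
      \<open>m - 1 = 2 * r + 2\<close>, and \<open>r\<close> is at most \<open>x\<close>.\<close>
    have "2 * (n - r) + 1 < m * q + m" unfolding q_def using dividend_less_times_div[of m "2 * (n - r) + 1"] by (simp add: m_def)
    then have "real (2 * (n - r) + 1) + 1 \<le> real (m * q + m)" by linarith
    then have lo: "2 * real n - 4 * x - 1 \<le> real (m * q)" using rx by (simp add: nr m_def)
    have pos: "0 \<le> 2 * real n - 4 * x - 1" using a1 by linarith
    have mx: "0 < real m" "real m \<le> 2 * x + 3" using rx by (auto simp: m_def)
    have lq: "(2 * real n - 4 * x - 1) / (2 * x + 3) \<le> real q"
    proof -
      have "(2 * real n - 4 * x - 1) / (2 * x + 3) \<le> (2 * real n - 4 * x - 1) / real m"
        using pos mx by (intro divide_left_mono) auto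
      also have "\<dots> \<le> real q" using lo mx by (simp add: divide_le_eq mult.commute)
      finally show ?thesis .
    qed
    have count: "4 * (real n)\<^sup>2 * (1 - \<epsilon>) \<le> real ((m * q)\<^sup>2) * (1 - \<epsilon> / 2)"
    proof -
      have "4 * (1 - \<epsilon>) * (real n)\<^sup>2 \<le> (2 * real n - 4 * x - 1)\<^sup>2 * (1 - \<epsilon> / 2)"
      proof -
        have "4 * (1 - \<epsilon>) < (2 * real n - 4 * x - 1)\<^sup>2 / (real n)\<^sup>2 * (1 - \<epsilon> / 2)"
          using a3 \<epsilon> by (subst (asm) pos_divide_less_eq) auto
        then have "4 * (1 - \<epsilon>) < (2 * real n - 4 * x - 1)\<^sup>2 * (1 - \<epsilon> / 2) / (real n)\<^sup>2" by simp
        then show ?thesis using n1 by (subst (asm) pos_less_divide_eq) auto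
      qed
      also have "\<dots> \<le> (real (m * q))\<^sup>2 * (1 - \<epsilon> / 2)"
        using \<epsilon> lo pos by (intro mult_right_mono power_mono) auto
      finally show ?thesis by (simp add: algebra_simps)
    qed
    have "measure age_measure (?E n) \<le> (2 * real n + 1)\<^sup>2 * 0.968 ^ r + real (m\<^sup>2) * exp (- \<delta> * real (q\<^sup>2))"
      using prob_small_largest_component[OF rx(3) rn m_def q1 mq _ Th count] \<epsilon> unfolding \<delta>_def by simp
    also have "(2 * real n + 1)\<^sup>2 * 0.968 ^ r \<le> 4 * real n ^ 2 * exp (- (c / 2) * x)"
    proof -
      have "(0.968::real) ^ r = exp (- c * real r)" unfolding ce by (simp add: exp_of_nat_mult[symmetric] mult.commute)
      also have "\<dots> \<le> exp (- c * (x - 1))" using c rx(2) by simp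
      \<comment> \<open>One of the two equal factors absorbs the constant \<open>9 * exp c\<close>
        by \<open>a4\<close>; \<open>exp c\<close> comes from rounding \<open>x\<close> down to
        \<open>r\<close>.\<close>
      also have "\<dots> = exp c * exp (- (c / 2) * x) * exp (- (c / 2) * x)"
        by (simp add: exp_add[symmetric] algebra_simps)
      finally have "(0.968::real) ^ r \<le> exp c * exp (- (c / 2) * x) * exp (- (c / 2) * x)" .
      moreover have "(2 * real n + 1)\<^sup>2 \<le> (3 * real n)\<^sup>2" using n1 by (intro power_mono) auto
      ultimately have "(2 * real n + 1)\<^sup>2 * 0.968 ^ r \<le> (3 * real n)\<^sup>2 * (exp c * exp (- (c / 2) * x) * exp (- (c / 2) * x))"
        by (intro mult_mono) auto
      also have "\<dots> = (9 * exp c * exp (- (c / 2) * x)) * (real n ^ 2 * exp (- (c / 2) * x))"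
        by (simp add: power_mult_distrib)
      also have "\<dots> \<le> 4 * (real n ^ 2 * exp (- (c / 2) * x))" using a4 by (rule mult_right_mono) simp
      finally show ?thesis by simp
    qed
    also have "real (m\<^sup>2) * exp (- \<delta> * real (q\<^sup>2)) \<le> exp (- 1 * \<epsilon> ^ 2 * x)"
    proof -
      have "real (m\<^sup>2) * exp (- \<delta> * real (q\<^sup>2)) \<le> 
         (2 * x + 3)\<^sup>2 * exp (- \<delta> * ((2 * real n - 4 * x - 1) / (2 * x + 3))\<^sup>2)"
      proof (rule mult_mono)
        show "real (m\<^sup>2) \<le> (2 * x + 3)\<^sup>2" using mx by (simp add: power_mono)
        have "((2 * real n - 4 * x - 1) / (2 * x + 3))\<^sup>2 \<le> (real q)\<^sup>2"
          using lq pos a2 by (intro power_mono) auto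
        then show "exp (- \<delta> * real (q\<^sup>2)) \<le> exp (- \<delta> * ((2 * real n - 4 * x - 1) / (2 * x + 3))\<^sup>2)"
          using \<delta> by simp
      qed auto
      also note a5
      also have "exp (- x) \<le> exp (- 1 * \<epsilon> ^ 2 * x)"
        using \<epsilon> a2 mult_right_mono[of "\<epsilon>\<^sup>2" 1 x] power_le_one[of \<epsilon> 2] by simp
      finally show ?thesis .
    qed
    finally show "measure age_measure (?E n) \<le> ?R n" unfolding x_def by simp
  qed
qed

text \<open>This event is later bounded from below by a smaller one, which requires it to be
  measurable. It depends only on the local maxima inside the box.\<close>

lemma sets_small_components:
  assumes "n \<ge> 1"
  shows "{age \<in> space age_measure.
     \<forall>GC. largest_component (first_layers (box_graph n) age 4) GC \<longrightarrow>
       (\<forall>K\<in>graph_components (first_layers (box_graph n) age 4). K \<noteq> GC \<longrightarrow> z2_diameter K \<le> d)}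
     \<in> sets age_measure"
proof -
  define Q where "Q S \<longleftrightarrow> (\<forall>GC. (GC \<in> linked_classes (grid n - S) \<and> (\<forall>K'\<in>linked_classes (grid n - S). card K' \<le> card GC)) \<longrightarrow>
       (\<forall>K\<in>linked_classes (grid n - S). K \<noteq> GC \<longrightarrow> z2_diameter K \<le> d))" for S
  have "{age. Q (loc_max age \<inter> grid (n - 1))} \<in> sets age_measure" by (rule sets_loc_max_Int) simp
  then show ?thesis
    unfolding Q_def largest_component_def graph_components_box[OF assms] grid_layers_def by simp
qed

lemma component_diameter_le:
  assumes "n \<ge> 1" "K \<in> graph_components (first_layers (box_graph n) age 4)"
  shows "z2_diameter K \<le> 4 * real n"
proof -
  have "K \<subseteq> grid n" using assms linked_in(2) unfolding graph_components_box[OF assms(1)] linked_classes_def grid_layers_def by blast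
  then have "sup_dist a b \<le> int (2 * n)" if "a \<in> K" "b \<in> K" for a b
  proof -
    have "a \<in> grid n" "b \<in> grid n" using that \<open>K \<subseteq> grid n\<close> by auto
    then show ?thesis unfolding sup_dist_def grid_def by auto
  qed
  then have "z2_diameter K \<le> 2 * real (2 * n)" by (rule z2_diameter_le)
  then show ?thesis by simp
qed

lemma small_components_whp:
  "\<exists>L :: real. \<forall>n::nat. n \<ge> 1 \<longrightarrow>
     measure age_measure {age \<in> space age_measure.
       \<forall>GC. largest_component (first_layers (box_graph n) age 4) GC \<longrightarrow>
         (\<forall>K\<in>graph_components (first_layers (box_graph n) age 4).
            K \<noteq> GC \<longrightarrow> z2_diameter K \<le> L * ln (real n))}
     \<ge> 1 - 1 / real n ^ 2"
proof -
  define c :: real where "c = - ln 0.968"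
  have c: "c > 0" unfolding c_def by simp
  have ce: "0.968 = exp (- c)" unfolding c_def by simp
  \<comment> \<open>Chosen to make \<open>0.968 ^ k n\<close> at most
    \<open>1 / (9 * real n ^ 4)\<close>; the at most \<open>9 * real n ^ 2\<close> starting points
    then leave \<open>1 / real n ^ 2\<close>.\<close>
  define k where "k n = nat \<lceil>(4 * ln (real n) + ln 9) / c\<rceil>" for n :: nat
  \<comment> \<open>From \<open>n = 2\<close> on, \<open>ln 9\<close> and the 1 lost by rounding up
    are bounded by multiples of \<open>ln (real n)\<close>.\<close>
  define b where "b = (4 + ln 9 / ln 2) / c + 1 / ln 2"
  have kle: "real (k n) \<le> b * ln (real n)" and kge: "(4 * ln (real n) + ln 9) / c \<le> real (k n)" and k1: "1 \<le> k n" 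
    if "2 \<le> n" for n
  proof -
    have l2: "0 < ln (2::real)" "ln 2 \<le> ln (real n)" using that by auto
    then have l0: "0 \<le> ln (real n)" by linarith
    have z: "0 < (4 * ln (real n) + ln 9) / c" using c l0 by (intro divide_pos_pos add_nonneg_pos) auto
    then show "(4 * ln (real n) + ln 9) / c \<le> real (k n)" unfolding k_def by linarith
    show "1 \<le> k n" using z unfolding k_def by linarith
    have "real (k n) \<le> (4 * ln (real n) + ln 9) / c + 1" using z unfolding k_def by linarith
    also have "\<dots> \<le> (4 * ln (real n) + (ln 9 / ln 2) * ln (real n)) / c + (1 / ln 2) * ln (real n)"
    proof (intro add_mono divide_right_mono order_refl)
      have "(ln 9 / ln 2) * ln (2::real) \<le> (ln 9 / ln 2) * ln (real n)" using l2 by (intro mult_left_mono) auto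
      then show "ln 9 \<le> ln 9 / ln 2 * ln (real n)" using l2 by simp
      have "(1 / ln 2) * ln (2::real) \<le> (1 / ln 2) * ln (real n)" using l2 by (intro mult_left_mono) auto
      then show "1 \<le> 1 / ln 2 * ln (real n)" using l2 by simp
    qed (use c l0 in auto)
    also have "\<dots> = b * ln (real n)" by (simp add: b_def algebra_simps add_divide_distrib)
    finally show "real (k n) \<le> b * ln (real n)" .
  qed
  have bpos: "b > 0" unfolding b_def using c by (intro add_pos_pos divide_pos_pos) auto
  then have "\<forall>\<^sub>F n in sequentially. (2 * (b * ln (real n)) + 1)\<^sup>2 < 2 * real n + 1" by real_asymp
  then obtain N where N: "\<And>n. n \<ge> N \<Longrightarrow> (2 * (b * ln (real n)) + 1)\<^sup>2 < 2 * real n + 1"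
    unfolding eventually_sequentially by blast
  \<comment> \<open>The first term serves \<open>n \<ge> N\<close>; the second makes the trivial
    bound \<open>4 * real n\<close> suffice for \<open>n\<close> from 2 to below \<open>N\<close>.
    For \<open>n = 1\<close> the required probability is 0.\<close>
  define L where "L = max (2 * b) (4 * real N / ln 2)"
  show ?thesis
  proof (intro exI[of _ L] allI impI)
    fix n :: nat assume n: "n \<ge> 1"
    let ?G = "{age \<in> space age_measure.
       \<forall>GC. largest_component (first_layers (box_graph n) age 4) GC \<longrightarrow>
         (\<forall>K\<in>graph_components (first_layers (box_graph n) age 4).
            K \<noteq> GC \<longrightarrow> z2_diameter K \<le> L * ln (real n))}"
    have G: "?G \<in> sets age_measure" by (rule sets_small_components[OF n])
    consider "n = 1" | "2 \<le> n" "n < N" | "2 \<le> n" "N \<le> n" using n by linarith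
    then show "1 - 1 / real n ^ 2 \<le> measure age_measure ?G"
    proof cases
      case 1
      then show ?thesis by simp
    next
      case 2
      have "4 * real n \<le> L * ln (real n)"
      proof -
        have "4 * real n \<le> (4 * real N / ln 2) * ln 2" using 2 by simp
        also have "\<dots> \<le> L * ln (real n)" unfolding L_def using 2 bpos by (intro mult_mono) (auto simp: le_max_iff_disj)
        finally show ?thesis .
      qed
      then have "?G = space age_measure" using component_diameter_le[OF n] by (auto intro: order_trans)
      then show ?thesis by (simp add: age.prob_space[unfolded space_age_measure])
    next
      case 3
      obtain B where B: "B \<in> sets age_measure" "{age. long_path (k n) n (loc_max age)} \<subseteq> B"
         "measure age_measure B \<le> (2 * real n + 1)\<^sup>2 * 0.968 ^ k n"
        using long_path_event[OF k1[OF 3(1)], of n] by blast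
      have "real ((2 * k n + 1)\<^sup>2) \<le> (2 * (b * ln (real n)) + 1)\<^sup>2"
        using kle[OF 3(1)] by (simp add: power_mono)
      also have "\<dots> < real (2 * n + 1)" using N[OF 3(2)] by simp
      finally have kn: "(2 * k n + 1)\<^sup>2 < 2 * n + 1" by (simp only: of_nat_less_iff)
      have Ln: "2 * real (k n) \<le> L * ln (real n)"
      proof -
        have "2 * real (k n) \<le> 2 * b * ln (real n)" using kle[OF 3(1)] by simp
        also have "\<dots> \<le> L * ln (real n)" unfolding L_def using n by (intro mult_right_mono) auto
        finally show ?thesis .
      qed
      have "space age_measure - B \<subseteq> ?G"
      proof
        fix age assume "age \<in> space age_measure - B"
        then have "\<not> long_path (k n) n (loc_max age)" using B(2) by blast
        from small_components[OF n this kn] Ln show "age \<in> ?G" by (fastforce intro: order_trans)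
      qed
      then have "measure age_measure (space age_measure - B) \<le> measure age_measure ?G"
        using G by (intro age.finite_measure_mono)
      moreover have "measure age_measure (space age_measure - B) = 1 - measure age_measure B"
        using B(1) by (rule age.prob_compl)
      moreover have "measure age_measure B \<le> 1 / real n ^ 2"
      proof -
        have "(0.968::real) ^ k n = exp (- (c * real (k n)))" unfolding ce by (simp add: exp_of_nat_mult[symmetric] mult.commute)
        also have "\<dots> \<le> exp (- (4 * ln (real n) + ln 9))" using kge[OF 3(1)] c by (simp add: divide_le_eq mult.commute)
        also have "\<dots> = 1 / (9 * real n ^ 4)"
        proof -
          have "4 * ln (real n) + ln 9 = ln (9 * real n ^ 4)" using n by (simp add: ln_mult ln_realpow)
          then show ?thesis using n by (simp add: exp_minus field_simps)
        qed
        finally have "(0.968::real) ^ k n \<le> 1 / (9 * real n ^ 4)" .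
        moreover have "(2 * real n + 1)\<^sup>2 \<le> (3 * real n)\<^sup>2" using n by (intro power_mono) auto
        ultimately have "(2 * real n + 1)\<^sup>2 * 0.968 ^ k n \<le> (3 * real n)\<^sup>2 * (1 / (9 * real n ^ 4))"
          by (intro mult_mono) auto
        also have "\<dots> = 1 / real n ^ 2" using n by (simp add: power_mult_distrib divide_simps flip: power_add)
        finally show ?thesis using B(3) by linarith
      qed
      ultimately show ?thesis by linarith
    qed
  qed
qed

theorem theorem4p16:
  shows "(\<exists>C M :: real. C > 0 \<and> M > 0 \<and>
           (\<forall>\<epsilon>\<in>{0<..<1::real}. \<forall>\<^sub>F n in sequentially.
              measure age_measure {age \<in> space age_measure.
                \<exists>GC. largest_component (first_layers (box_graph n) age 4) GC \<and>
                     real (card GC) < 4 * real n ^ 2 * (1 - \<epsilon>) * Theta}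
              \<le> exp (- C * \<epsilon> ^ 2 * real n powr (1 / 5))
                + 4 * real n ^ 2 * exp (- M * real n powr (1 / 5))))
       \<and> (\<exists>L :: real. \<forall>n::nat. n \<ge> 1 \<longrightarrow>
            measure age_measure {age \<in> space age_measure.
              \<forall>GC. largest_component (first_layers (box_graph n) age 4) GC \<longrightarrow>
                (\<forall>K\<in>graph_components (first_layers (box_graph n) age 4).
                   K \<noteq> GC \<longrightarrow> z2_diameter K \<le> L * ln (real n))}
            \<ge> 1 - 1 / real n ^ 2)"
proof (intro conjI)
  have "(0::real) < - ln 0.968 / 2" by simp
  then show "\<exists>C M :: real. C > 0 \<and> M > 0 \<and>
           (\<forall>\<epsilon>\<in>{0<..<1::real}. \<forall>\<^sub>F n in sequentially.
              measure age_measure {age \<in> space age_measure.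
                \<exists>GC. largest_component (first_layers (box_graph n) age 4) GC \<and>
                     real (card GC) < 4 * real n ^ 2 * (1 - \<epsilon>) * Theta}
              \<le> exp (- C * \<epsilon> ^ 2 * real n powr (1 / 5))
                + 4 * real n ^ 2 * exp (- M * real n powr (1 / 5)))"
    by (intro exI[of _ 1] exI[of _ "- ln 0.968 / 2"] conjI ballI largest_component_lower_tail) simp_all
qed (rule small_components_whp)

end
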